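(* Let $c\ge 0$, $d\in\{0,1,2,\dots\}$ and $\lambda>0$ be fixed, set $q=e^{-\lambda/N}$ and $\alpha=cN+d$, and let $\nu_{n,N}=\frac1n\sum_{j=1}^n\delta_{x^{(j)}_{n,N}}$ be the normalized zero counting measure of the little $q$-Laguerre polynomial $p_n(x;q^{\alpha}\,|\,q)$. Then as $n,N\to\infty$ with $n/N\to1$, for every continuous function $f$ on $[0,1]$, $\int f\,d\nu_{n,N}\to\int_0^1 f(x)\rho^{(c)}(x)\,dx$.
   Context: For $\mathsf{a}\in(0,1/q)$ the little $q$-Laguerre polynomials $p_n(x)=p_n(x;\mathsf{a}\,|\,q)$ are defined by $p_0(x)=1$, $p_1(x)=1-\frac{x}{1-\mathsf{a}q}$ and, for $n\ge1$, $q^n(1-\mathsf{a}q^{n+1})p_{n+1}(x)+\big(x-q^n(1-\mathsf{a}q^{n+1})-\mathsf{a}q^n(1-q^n)\big)p_n(x)+\mathsf{a}q^n(1-q^n)p_{n-1}(x)=0$; here $\mathsf{a}=q^{\alpha}$. $q$-deformed Marchenko–Pastur law: let $\lambda_c$ be the unique positive number with $e^{-\lambda_c}(1+e^{-c\lambda_c})=1$; put $\mathsf{s}=e^{-\lambda}$, $a=\big(\sqrt{\mathsf{s}(1-\mathsf{s}^{c+1})}-\sqrt{\mathsf{s}^{c+1}(1-\mathsf{s})}\big)^2$, $b=\big(\sqrt{\mathsf{s}(1-\mathsf{s}^{c+1})}+\sqrt{\mathsf{s}^{c+1}(1-\mathsf{s})}\big)^2$, and $\rho^{(c)}(x)=\frac{2}{\pi\lambda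 x}\arctan\Big(\frac{\sqrt{(x-a)(b-x)}}{(\sqrt{1-x}+\sqrt{1-a})(\sqrt{1-x}+\sqrt{1-b})}\Big)\mathbf{1}_{(a,b)}(x)$ if $\lambda\le\lambda_c$, and $\rho^{(c)}(x)=\frac{2}{\pi\lambda x}\arctan\Big(\sqrt{\frac{x-a}{b-x}}\frac{\sqrt{1-x}+\sqrt{1-b}}{\sqrt{1-x}+\sqrt{1-a}}\Big)\mathbf{1}_{(a,b)}(x)+\frac{1}{\lambda x}\mathbf{1}_{(b,1)}(x)$ if $\lambda>\lambda_c$. *)

theory Defs
  imports "HOL-Analysis.Analysis" "HOL-Computational_Algebra.Polynomial"
begin

fun little_q_laguerre :: "real \<Rightarrow> real \<Rightarrow> nat \<Rightarrow> real poly" where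
  "little_q_laguerre a q 0 = 1"
| "little_q_laguerre a q (Suc 0) = [:1, - 1 / (1 - a * q):]"
| "little_q_laguerre a q (Suc (Suc n)) =
     smult (- 1 / (q ^ Suc n * (1 - a * q ^ Suc (Suc n))))
       ([: - (q ^ Suc n * (1 - a * q ^ Suc (Suc n))) - a * q ^ Suc n * (1 - q ^ Suc n), 1 :]
          * little_q_laguerre a q (Suc n)
        + smult (a * q ^ Suc n * (1 - q ^ Suc n)) (little_q_laguerre a q n))"

definition zero_counting_integral :: "nat \<Rightarrow> real poly \<Rightarrow> (real \<Rightarrow> real) \<Rightarrow> real" where
  "zero_counting_integral n p f =
     (1 / real n) * (\<Sum>x\<in>{x. poly p x = 0}. real (order x p) * f x)"

definition lambda_crit :: "real \<Rightarrow> real" where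
  "lambda_crit c = (THE l. l > 0 \<and> exp (- l) * (1 + exp (- c * l)) = 1)"

definition mp_a :: "real \<Rightarrow> real \<Rightarrow> real" where
  "mp_a c lam = (let s = exp (- lam) in
     (sqrt (s * (1 - s powr (c + 1))) - sqrt (s powr (c + 1) * (1 - s)))^2)"

definition mp_b :: "real \<Rightarrow> real \<Rightarrow> real" where
  "mp_b c lam = (let s = exp (- lam) in
     (sqrt (s * (1 - s powr (c + 1))) + sqrt (s powr (c + 1) * (1 - s)))^2)"

definition rho_qMP :: "real \<Rightarrow> real \<Rightarrow> real \<Rightarrow> real" where
  "rho_qMP c lam x = (let a = mp_a c lam; b = mp_b c lam in
     if lam \<le> lambda_crit c then
       (if a < x \<and> x < b then
          2 / (pi * lam * x) * arctan (sqrt ((x - a) * (b - x)) /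
            ((sqrt (1 - x) + sqrt (1 - a)) * (sqrt (1 - x) + sqrt (1 - b))))
        else 0)
     else
       (if a < x \<and> x < b then
          2 / (pi * lam * x) * arctan (sqrt ((x - a) / (b - x)) *
            ((sqrt (1 - x) + sqrt (1 - b)) / (sqrt (1 - x) + sqrt (1 - a))))
        else 0)
       + (if b < x \<and> x < 1 then 1 / (lam * x) else 0))"

end

theory Submission
  imports Defs "HOL-Computational_Algebra.Fundamental_Theorem_Algebra"
begin

text \<open>
  The zeros of \<open>p\<^sub>n\<close> are the eigenvalues of a truncated Jacobi matrix with diagonal
  \<open>A\<^sub>i + C\<^sub>i\<close> and off-diagonal \<open>- sqrt (A\<^sub>i C\<^sub>i\<^sub>+\<^sub>1)\<close>, where \<open>A\<^sub>i = q\<^sup>i (1 - a q\<^sup>i\<^sup>+\<^sup>1)\<close> and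
  \<open>C\<^sub>i = a q\<^sup>i (1 - q\<^sup>i)\<close>. These entries are asymptotically functions of \<open>u = q\<^sup>i\<close> and vary slowly
  with \<open>i\<close>, so near the \<open>i\<close>-th row the matrix looks like the Toeplitz matrix with symbol
  \<open>A + C - 2 sqrt (A C) cos \<theta>\<close>, \<open>A = u (1 - w u)\<close>, \<open>C = w u (1 - u)\<close>, \<open>w = exp (- c \<lambda>)\<close>. Averaging
  the diagonal of the \<open>k\<close>-th power of the matrix gives the limiting moments as an average over
  \<open>u = exp (- \<lambda> t)\<close>, \<open>0 \<le> t \<le> 1\<close>, of moments of arcsine laws. Exchanging the order of integration,
  the density of this mixture at \<open>x\<close> is an integral over \<open>t\<close> which the substitution
  \<open>x / u = 1 + w - 2 sqrt (w (1 - x)) cos \<theta>\<close> turns into the length of an interval of angles.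
\<close>

section \<open>Power sums of zeros and Jacobi matrices\<close>

text \<open>No matrix type occurs: the eigenvector at a zero \<open>x\<close> of \<open>P n\<close>
  is the list of values \<open>P i x\<close>, \<open>i < n\<close>. Christoffel-Darboux makes these
  vectors orthogonal; reading diagonal entries as sums over zeros also requires orthonormal rows,
  hence \<open>n\<close> distinct real zeros. This is why realness and simplicity are proved first.
  Two degeneracies shape the estimates. The matrix has a first row while the Toeplitz model is
  bi-infinite, but \<open>C\<close> vanishes at \<open>u = 1\<close>, so the model does not couple
  to the absent row and no boundary term arises. The same vanishing makes the off-diagonal square
  roots non-Lipschitz, so their errors are measured by \<open>sqrt\<close>. The integrals are
  exchanged for a nonnegative kernel, so its inverse square root singularities call for no separate
  integrability argument. In the density, the root of \<open>1 - mp_b c lam\<close> with its natural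
  sign changes sign exactly at the critical value of \<lambda>; in terms of it the two formulas
  become one. Moments suffice because polynomials are dense in the continuous functions on
  \<open>[0, 1]\<close>.\<close>

text \<open>The squared deviations of the row products from the identity sum up to \<open>card I - card J\<close>.\<close>

lemma orthonormal_columns_imp_rows:
  fixes V :: "'i \<Rightarrow> 'j \<Rightarrow> real"
  assumes fin: "finite I" "finite J" and card: "card I = card J"
    and orth: "\<And>j j'. j \<in> J \<Longrightarrow> j' \<in> J \<Longrightarrow> (\<Sum>i\<in>I. V i j * V i j') = of_bool (j = j')"
    and i: "i \<in> I" and l: "l \<in> I"
  shows "(\<Sum>j\<in>J. V i j * V l j) = of_bool (i = l)"
proof -
  define W where "W i l = (\<Sum>j\<in>J. V i j * V l j)" for i l
  have sq: "(\<Sum>l\<in>I. (of_bool (i = l) - W i l)\<^sup>2) = 1 - W i i" if i: "i \<in> I" for i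
  proof -
    \<comment> \<open>Column orthonormality makes \<open>W\<close> a symmetric projection; this is
      the diagonal of \<open>W * W = W\<close>.\<close>
    have "(\<Sum>l\<in>I. (W i l)\<^sup>2) = (\<Sum>l\<in>I. \<Sum>j\<in>J. \<Sum>j'\<in>J. V i j * V i j' * (V l j * V l j'))"
      by (simp add: W_def power2_eq_square sum_product algebra_simps)
    also have "\<dots> = (\<Sum>j\<in>J. \<Sum>l\<in>I. \<Sum>j'\<in>J. V i j * V i j' * (V l j * V l j'))"
      by (rule sum.swap)
    also have "\<dots> = (\<Sum>j\<in>J. \<Sum>j'\<in>J. \<Sum>l\<in>I. V i j * V i j' * (V l j * V l j'))"
      by (intro sum.cong refl sum.swap)
    also have "\<dots> = (\<Sum>j\<in>J. \<Sum>j'\<in>J. V i j * V i j' * of_bool (j = j'))"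
      by (intro sum.cong refl) (simp add: orth flip: sum_distrib_left)
    also have "\<dots> = (\<Sum>j\<in>J. \<Sum>j'\<in>J. if j = j' then V i j * V i j' else 0)"
      by (intro sum.cong refl) simp
    also have "\<dots> = W i i"
      using fin by (simp add: W_def)
    finally have WW: "(\<Sum>l\<in>I. (W i l)\<^sup>2) = W i i" .
    have "(\<Sum>l\<in>I. (of_bool (i = l) - W i l)\<^sup>2)
        = (\<Sum>l\<in>I. (if i = l then 1 - 2 * W i l else 0) + (W i l)\<^sup>2)"
      by (intro sum.cong refl) (simp add: power2_eq_square algebra_simps)
    also have "\<dots> = 1 - 2 * W i i + (\<Sum>l\<in>I. (W i l)\<^sup>2)"
      using fin i by (simp add: sum.distrib)
    finally show ?thesis using WW by simp
  qed
  have "(\<Sum>i\<in>I. W i i) = (\<Sum>j\<in>J. \<Sum>i\<in>I. V i j * V i j)"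
    unfolding W_def by (rule sum.swap)
  also have "\<dots> = card I"
    by (simp add: orth card)
  finally have "(\<Sum>i\<in>I. \<Sum>l\<in>I. (of_bool (i = l) - W i l)\<^sup>2) = 0"
    by (simp add: sq sum_subtractf)
  hence "\<forall>i\<in>I. (\<Sum>l\<in>I. (of_bool (i = l) - W i l)\<^sup>2) = 0"
    by (subst (asm) sum_nonneg_eq_0_iff) (auto simp: fin sum_nonneg)
  hence "(\<Sum>l\<in>I. (of_bool (i = l) - W i l)\<^sup>2) = 0"
    using i by blast
  hence "\<forall>l\<in>I. (of_bool (i = l) - W i l)\<^sup>2 = 0"
    by (subst (asm) sum_nonneg_eq_0_iff) (auto simp: fin)
  thus ?thesis using l by (auto simp: W_def)
qed

text \<open>Entry \<open>(i, l)\<close> of the \<open>k\<close>-th power of the half-infinite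
  symmetric tridiagonal matrix with diagonal \<open>d\<close> and off-diagonal \<open>b\<close>. The
  recursion multiplies from the left, so the row moves while \<open>l\<close> stays fixed.\<close>

fun jacobi_power :: "(nat \<Rightarrow> real) \<Rightarrow> (nat \<Rightarrow> real) \<Rightarrow> nat \<Rightarrow> nat \<Rightarrow> nat \<Rightarrow> real" where
  "jacobi_power d b 0 i l = of_bool (i = l)"
| "jacobi_power d b (Suc k) 0 l = d 0 * jacobi_power d b k 0 l + b 0 * jacobi_power d b k 1 l"
| "jacobi_power d b (Suc k) (Suc i) l = d (Suc i) * jacobi_power d b k (Suc i) l
     + b (Suc i) * jacobi_power d b k (Suc (Suc i)) l + b i * jacobi_power d b k i l"

text \<open>For fixed \<open>x\<close> the values \<open>P i x\<close> form a formal eigenvector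
  with eigenvalue \<open>x\<close>; at a zero of \<open>P n\<close> the first \<open>n\<close> of
  them are an eigenvector of the truncated matrix. The normalisation at index 0 keeps it
  nonzero.\<close>

locale jacobi_recurrence =
  fixes d b :: "nat \<Rightarrow> real" and P :: "nat \<Rightarrow> real \<Rightarrow> real"
  assumes P_0: "P 0 x = 1"
    and mult_P_0: "x * P 0 x = d 0 * P 0 x + b 0 * P 1 x"
    and mult_P_Suc: "x * P (Suc i) x
          = d (Suc i) * P (Suc i) x + b (Suc i) * P (Suc (Suc i)) x + b i * P i x"
begin

text \<open>Each factor of the matrix moves the index by at most one, so for
  \<open>i + k \<le> M\<close> the sum up to \<open>M\<close> already contains the whole row
  \<open>i\<close>.\<close>

lemma power_mult_P:
  "i + k \<le> M \<Longrightarrow> x ^ k * P i x = (\<Sum>l\<le>M. jacobi_power d b k i l * P l x)"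
proof (induction k arbitrary: i)
  case 0
  have "(\<Sum>l\<le>M. jacobi_power d b 0 i l * P l x) = (\<Sum>l\<le>M. if i = l then P l x else 0)"
    by (intro sum.cong) auto
  thus ?case using 0 by simp
next
  case (Suc k)
  show ?case
  proof (cases i)
    case 0
    have "x ^ Suc k * P i x = d 0 * (x ^ k * P 0 x) + b 0 * (x ^ k * P 1 x)"
      using arg_cong[OF mult_P_0[of x], of "\<lambda>t. x ^ k * t"] 0 by (simp add: algebra_simps)
    also have "\<dots> = (\<Sum>l\<le>M. jacobi_power d b (Suc k) i l * P l x)"
      using Suc.prems 0
      by (subst (1 2) Suc.IH) (auto simp: sum_distrib_left algebra_simps simp flip: sum.distrib)
    finally show ?thesis .
  next
    case (Suc j)
    have "x ^ Suc k * P i x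
        = d (Suc j) * (x ^ k * P (Suc j) x) + b (Suc j) * (x ^ k * P (Suc (Suc j)) x) + b j * (x ^ k * P j x)"
      using arg_cong[OF mult_P_Suc[of x j], of "\<lambda>t. x ^ k * t"] Suc by (simp add: algebra_simps)
    also have "\<dots> = (\<Sum>l\<le>M. jacobi_power d b (Suc k) i l * P l x)"
      using Suc.prems Suc
      by (subst (1 2 3) Suc.IH) (auto simp: sum_distrib_left algebra_simps simp flip: sum.distrib)
    finally show ?thesis .
  qed
qed

text \<open>The symmetry of the off-diagonal entries makes the sum telescope. At two zeros of
  \<open>P (Suc n)\<close> the right-hand side vanishes, so distinct zeros give orthogonal
  vectors.\<close>

lemma christoffel_darboux:
  "(x - y) * (\<Sum>i<Suc n. P i x * P i y) = b n * (P (Suc n) x * P n y - P n x * P (Suc n) y)"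
proof (induction n)
  case 0
  show ?case using mult_P_0[of x] mult_P_0[of y] by (simp add: P_0 algebra_simps)
next
  case (Suc n)
  have "(x - y) * (P (Suc n) x * P (Suc n) y)
      = (x * P (Suc n) x) * P (Suc n) y - P (Suc n) x * (y * P (Suc n) y)"
    by (simp add: algebra_simps)
  also have "\<dots> = b (Suc n) * (P (Suc (Suc n)) x * P (Suc n) y - P (Suc n) x * P (Suc (Suc n)) y)
                 - b n * (P (Suc n) x * P n y - P n x * P (Suc n) y)"
    unfolding mult_P_Suc by (simp add: algebra_simps)
  finally show ?case using Suc by (simp add: algebra_simps)
qed

text \<open>The trace of the \<open>k\<close>-th power of the truncated Jacobi matrix is the power sum of its
  eigenvalues; truncation only affects the last \<open>k\<close> diagonal entries.\<close>

lemma power_sum_eq: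
  assumes zeros: "\<And>x. x \<in> R \<Longrightarrow> P n x = 0" and card: "card R = n" and n: "n > 0"
    and R: "R \<subseteq> {0..1}"
  shows "\<bar>(\<Sum>x\<in>R. x ^ k) - (\<Sum>i<n - k. jacobi_power d b k i i)\<bar> \<le> k"
proof -
  have fin: "finite R" using card n card_ge_0_finite by blast
  obtain m where m: "n = Suc m" using n by (cases n) auto
  define h where "h x = (\<Sum>i<n. P i x * P i x)" for x
  have h_pos: "h x > 0" for x
  proof -
    have "1 \<le> h x" unfolding h_def m sum.lessThan_Suc_shift by (simp add: P_0 sum_nonneg)
    thus ?thesis by simp
  qed
  define V where "V i x = P i x / sqrt (h x)" for i x
  have col: "(\<Sum>i<n. V i x * V i y) = of_bool (x = y)" if "x \<in> R" "y \<in> R" for x y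
  proof -
    have eq: "(\<Sum>i<n. V i x * V i y) = (\<Sum>i<n. P i x * P i y) / (sqrt (h x) * sqrt (h y))"
      by (simp add: V_def sum_divide_distrib)
    show ?thesis
    proof (cases "x = y")
      case True
      thus ?thesis unfolding eq using h_pos[of x] by (simp add: h_def[symmetric])
    next
      case False
      thus ?thesis unfolding eq using christoffel_darboux[of x y m] zeros that by (simp add: m)
    qed
  qed
  \<comment> \<open>There are as many zeros as rows, so the square array \<open>V\<close> is
    orthogonal in both directions.\<close>
  have row: "(\<Sum>x\<in>R. V i x * V l x) = of_bool (i = l)" if "i < n" "l < n" for i l
    by (rule orthonormal_columns_imp_rows[of "{..<n}"]) (use that fin card col in auto)
  \<comment> \<open>By the spectral decomposition this is a diagonal entry of the
    \<open>k\<close>-th power of the truncated matrix.\<close>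
  define \<mu> where "\<mu> i = (\<Sum>x\<in>R. x ^ k * (V i x * V i x))" for i
  \<comment> \<open>From these rows \<open>k\<close> steps never reach index \<open>n\<close>, so
    truncated and infinite matrix agree.\<close>
  have mu: "\<mu> i = jacobi_power d b k i i" if i: "i < n - k" for i
  proof -
    have "x ^ k * V i x = (\<Sum>l<n. jacobi_power d b k i l * V l x)" for x
      using power_mult_P[of i k m x] i m
      by (simp add: V_def lessThan_Suc_atMost flip: sum_divide_distrib)
    hence "x ^ k * (V i x * V i x) = (\<Sum>l<n. jacobi_power d b k i l * (V i x * V l x))" for x
      by (simp only: mult.assoc[symmetric] sum_distrib_right)
        (intro sum.cong refl, simp add: mult_ac)
    hence "\<mu> i = (\<Sum>x\<in>R. \<Sum>l<n. jacobi_power d b k i l * (V i x * V l x))"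
      unfolding \<mu>_def by simp
    also have "\<dots> = (\<Sum>l<n. jacobi_power d b k i l * (\<Sum>x\<in>R. V i x * V l x))"
      by (subst sum.swap) (simp add: sum_distrib_left)
    also have "\<dots> = (\<Sum>l<n. if i = l then jacobi_power d b k i l else 0)"
      using i by (intro sum.cong refl) (simp add: row)
    also have "\<dots> = jacobi_power d b k i i" using i by simp
    finally show ?thesis .
  qed
  \<comment> \<open>In the remaining rows a crude bound suffices: \<open>\<mu> i\<close> averages
    values \<open>x ^ k\<close> in \<open>[0, 1]\<close> with weights of total mass 1.\<close>
  have mu01: "0 \<le> \<mu> i \<and> \<mu> i \<le> 1" if "i < n" for i
  proof -
    have *: "0 \<le> x ^ k" "x ^ k \<le> 1" if "x \<in> R" for x using that R by (auto intro!: power_le_one)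
    have "\<mu> i \<le> (\<Sum>x\<in>R. 1 * (V i x * V i x))"
      unfolding \<mu>_def using * by (intro sum_mono mult_right_mono) auto
    moreover have "0 \<le> \<mu> i" unfolding \<mu>_def using * by (intro sum_nonneg) auto
    ultimately show ?thesis using row[OF that that] by simp
  qed
  have "(\<Sum>x\<in>R. x ^ k) = (\<Sum>x\<in>R. x ^ k * (\<Sum>i<n. V i x * V i x))"
    by (intro sum.cong refl) (simp add: col)
  also have "\<dots> = (\<Sum>i<n. \<mu> i)"
    unfolding \<mu>_def by (subst sum.swap) (simp add: sum_distrib_left)
  also have "{..<n} = {..<n - k} \<union> {n - k..<n}" by auto
  also have "(\<Sum>i\<in>\<dots>. \<mu> i) = (\<Sum>i<n - k. jacobi_power d b k i i) + (\<Sum>i=n - k..<n. \<mu> i)"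
    by (subst sum.union_disjoint) (auto simp: mu)
  finally have "(\<Sum>x\<in>R. x ^ k) - (\<Sum>i<n - k. jacobi_power d b k i i) = (\<Sum>i=n - k..<n. \<mu> i)"
    by simp
  moreover have "0 \<le> (\<Sum>i=n - k..<n. \<mu> i)" by (intro sum_nonneg) (use mu01 in auto)
  \<comment> \<open>Truncated subtraction leaves at most \<open>k\<close> rows here, also when
    \<open>k\<close> exceeds \<open>n\<close>.\<close>
  moreover have "(\<Sum>i=n - k..<n. \<mu> i) \<le> (\<Sum>i=n - k..<n. 1)" by (intro sum_mono) (use mu01 in auto)
  ultimately show ?thesis by simp
qed

end

section \<open>Zeros of the little q-Laguerre polynomials\<close>

text \<open>Over the complex numbers a square-free polynomial has exactly as many roots as its
  degree; if all of them are real, the count carries over to the real roots.\<close>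

lemma card_real_roots_eq_degree:
  fixes p :: "real poly"
  assumes real_roots: "\<And>z. poly (map_poly complex_of_real p) z = 0 \<Longrightarrow> z \<in> \<real>"
    and simple: "rsquarefree p"
  shows "card {x. poly p x = 0} = degree p"
proof -
  let ?c = "map_poly complex_of_real p"
  have of_real: "poly (map_poly complex_of_real r) (of_real x) = of_real (poly r x)" for r x
    by (induction r) (auto simp: map_poly_pCons)
  have pderiv: "pderiv ?c = map_poly complex_of_real (pderiv p)"
    by (rule poly_eqI) (simp add: coeff_pderiv coeff_map_poly)
  have "rsquarefree ?c"
    unfolding rsquarefree_roots
  proof (intro allI notI, elim conjE)
    fix z assume z: "poly ?c z = 0" "poly (pderiv ?c) z = 0"
    then obtain x where "z = complex_of_real x"
      using real_roots by (auto elim: Reals_cases)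
    thus False
      using z simple by (auto simp: pderiv rsquarefree_roots of_real)
  qed
  hence "degree ?c = degree (smult (lead_coeff ?c) (\<Prod>z|poly ?c z = 0. [:-z, 1:]))"
    by (simp only: complex_poly_decompose_rsquarefree)
  also have "\<dots> = degree (\<Prod>z|poly ?c z = 0. [:-z, 1:])"
    using \<open>rsquarefree ?c\<close> by (simp add: rsquarefree_def)
  also have "\<dots> = card {z. poly ?c z = 0}"
    by (subst degree_prod_sum_eq) auto
  also have "{z. poly ?c z = 0} = complex_of_real ` {x. poly p x = 0}"
  proof (intro equalityI subsetI)
    fix z assume z: "z \<in> {z. poly ?c z = 0}"
    then obtain x where "z = complex_of_real x"
      using real_roots by (auto elim: Reals_cases)
    thus "z \<in> complex_of_real ` {x. poly p x = 0}"
      using z by (auto simp: of_real)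
  qed (auto simp: of_real)
  also have "card \<dots> = card {x. poly p x = 0}"
    by (intro card_image) (auto simp: inj_on_def)
  finally show ?thesis by (simp add: degree_map_poly)
qed

section \<open>Recurrence coefficients, location and simplicity of the zeros\<close>

definition qL_A :: "real \<Rightarrow> real \<Rightarrow> nat \<Rightarrow> real" where
  "qL_A a q i = q ^ i * (1 - a * q ^ Suc i)"

definition qL_C :: "real \<Rightarrow> real \<Rightarrow> nat \<Rightarrow> real" where
  "qL_C a q i = a * q ^ i * (1 - q ^ i)"

locale little_q_laguerre_params =
  fixes a q :: real
  assumes a_pos: "0 < a" and q_pos: "0 < q" and q_less_1: "q < 1" and aq_less_1: "a * q < 1"
begin

abbreviation "A \<equiv> qL_A a q"
abbreviation "C \<equiv> qL_C a q"
abbreviation "p \<equiv> little_q_laguerre a q"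

lemma A_pos: "A i > 0"
proof -
  have "q ^ i \<le> 1" using q_pos q_less_1 by (intro power_le_one) auto
  hence "a * q * q ^ i \<le> a * q * 1"
    using a_pos q_pos by (intro mult_left_mono) auto
  hence "a * q ^ Suc i < 1" using aq_less_1 by (simp add: mult_ac)
  thus ?thesis using q_pos by (simp add: qL_A_def)
qed

lemma C_0 [simp]: "C 0 = 0"
  by (simp add: qL_C_def)

lemma C_Suc_pos: "C (Suc i) > 0"
  using q_pos q_less_1 a_pos power_Suc_less_one[of q i] by (simp add: qL_C_def)

lemma p_1: "smult (A 0) (p 1) = [:A 0, -1:]"
  using A_pos[of 0] by (simp add: qL_A_def)

lemma p_Suc_Suc:
  "smult (A (Suc i)) (p (Suc (Suc i)))
     = [:A (Suc i) + C (Suc i), -1:] * p (Suc i) - smult (C (Suc i)) (p i)"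
proof -
  have rec: "p (Suc (Suc i)) = smult (- 1 / A (Suc i))
      ([:- A (Suc i) - C (Suc i), 1:] * p (Suc i) + smult (C (Suc i)) (p i))"
    by (simp add: qL_A_def qL_C_def del: power_Suc mult_pCons_left)
  have "smult (A (Suc i)) (p (Suc (Suc i)))
      = - ([:- A (Suc i) - C (Suc i), 1:] * p (Suc i) + smult (C (Suc i)) (p i))"
    unfolding rec using A_pos[of "Suc i"] by (simp del: mult_pCons_left)
  also have "\<dots> = - [:- A (Suc i) - C (Suc i), 1:] * p (Suc i) - smult (C (Suc i)) (p i)"
    by (simp only: minus_add_distrib minus_mult_left diff_conv_add_uminus)
  finally show ?thesis by (simp del: mult_pCons_left)
qed

declare little_q_laguerre.simps(2,3) [simp del]

lemma poly_p_1: "A 0 * poly (p 1) x = A 0 - x"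
  using arg_cong[OF p_1, of "\<lambda>r. poly r x"] by simp

lemma poly_p_Suc_Suc:
  "A (Suc i) * poly (p (Suc (Suc i))) x
     = (A (Suc i) + C (Suc i) - x) * poly (p (Suc i)) x - C (Suc i) * poly (p i) x"
  using arg_cong[OF p_Suc_Suc, of "\<lambda>r. poly r x"] by (simp add: algebra_simps)

lemma degree_p: "degree (p i) = i"
proof (induction i rule: induct_nat_012)
  case 1
  have "degree (smult (A 0) (p 1)) = 1" unfolding p_1 by simp
  thus ?case using A_pos[of 0] by simp
next
  case (ge2 i)
  have ne: "p (Suc i) \<noteq> 0" using ge2 by auto
  have "degree ([:A (Suc i) + C (Suc i), -1:] * p (Suc i)) = Suc (Suc i)"
    using ne ge2 by (subst degree_mult_eq) auto
  moreover have "degree (- smult (C (Suc i)) (p i)) < Suc (Suc i)"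
    using ge2 by (simp add: degree_smult_eq)
  ultimately have "degree ([:A (Suc i) + C (Suc i), -1:] * p (Suc i) + - smult (C (Suc i)) (p i)) = Suc (Suc i)"
    by (subst degree_add_eq_left) auto
  hence "degree (smult (A (Suc i)) (p (Suc (Suc i)))) = Suc (Suc i)"
    unfolding p_Suc_Suc by (simp del: mult_pCons_left)
  thus ?case using A_pos[of "Suc i"] by simp
qed auto

text \<open>The recurrence expresses \<open>A (Suc i)\<close> times one increment as
  \<open>C (Suc i)\<close> times the previous increment plus \<open>- x * p (Suc i)\<close>. For
  \<open>x \<le> 0\<close> positivity and growth in the degree therefore support each other in one
  induction.\<close>

lemma p_pos_of_nonpos:
  assumes "x \<le> 0"
  shows "poly (p i) x > 0"
proof -
  have "0 < poly (p i) x \<and> poly (p i) x \<le> poly (p (Suc i)) x"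
  proof (induction i)
    case 0
    have "A 0 * 1 \<le> A 0 * poly (p 1) x" unfolding poly_p_1 using assms by simp
    thus ?case using A_pos[of 0] by simp
  next
    case (Suc i)
    have pos: "poly (p (Suc i)) x > 0" using Suc by linarith
    have "A (Suc i) * (poly (p (Suc (Suc i))) x - poly (p (Suc i)) x)
        = C (Suc i) * (poly (p (Suc i)) x - poly (p i) x) - x * poly (p (Suc i)) x"
      unfolding right_diff_distrib[of "A (Suc i)"] poly_p_Suc_Suc by (simp add: algebra_simps)
    also have "\<dots> \<ge> 0"
    proof -
      have "x * poly (p (Suc i)) x \<le> 0"
        using pos assms by (simp add: mult_nonpos_nonneg)
      moreover have "0 \<le> C (Suc i) * (poly (p (Suc i)) x - poly (p i) x)"
        using C_Suc_pos[of i] Suc by simp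
      ultimately show ?thesis by linarith
    qed
    finally have "poly (p (Suc (Suc i))) x - poly (p (Suc i)) x \<ge> 0"
      using A_pos[of "Suc i"] by (simp add: zero_le_mult_iff)
    thus ?case using pos by simp
  qed
  thus ?thesis by simp
qed

text \<open>The lower bound for the ratio \<open>- p (i + 1) / p i\<close> is its value at \<open>x = 1\<close>.\<close>

lemma p_sign_of_ge_1:
  assumes "x \<ge> 1"
  shows "(- 1) ^ i * poly (p i) x > 0"
proof -
  let ?g = "\<lambda>i. (- 1) ^ i * poly (p i) x"
  have "0 < ?g i \<and> a * q ^ Suc i * ?g i \<le> (1 - a * q ^ Suc i) * ?g (Suc i)"
  proof (induction i)
    case 0
    show ?case using poly_p_1[of x] assms by (simp add: qL_A_def algebra_simps)
  next
    case (Suc i)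
    have e: "1 - a * q ^ Suc i > 0"
      using A_pos[of i] q_pos by (simp add: qL_A_def zero_less_mult_iff)
    have "0 < a * q ^ Suc i * ?g i" using Suc a_pos q_pos by simp
    hence "0 < (1 - a * q ^ Suc i) * ?g (Suc i)" using Suc by linarith
    hence pos: "?g (Suc i) > 0" using e zero_less_mult_pos by blast
    have "A (Suc i) * ?g (Suc (Suc i)) = (- 1) ^ i * (A (Suc i) * poly (p (Suc (Suc i))) x)"
      by simp
    also have "\<dots> = (x - A (Suc i) - C (Suc i)) * ?g (Suc i) - C (Suc i) * ?g i"
      unfolding poly_p_Suc_Suc by (simp add: algebra_simps)
    finally have "A (Suc i) * ?g (Suc (Suc i))
        = (x - A (Suc i) - C (Suc i)) * ?g (Suc i) - (1 - q ^ Suc i) * (a * q ^ Suc i * ?g i)"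
      by (simp add: qL_C_def)
    moreover have "(1 - q ^ Suc i) * (a * q ^ Suc i * ?g i)
        \<le> (1 - q ^ Suc i) * ((1 - a * q ^ Suc i) * ?g (Suc i))"
      using Suc q_pos q_less_1 by (intro mult_left_mono) (auto intro!: power_le_one simp del: power_Suc)
    ultimately have "A (Suc i) * ?g (Suc (Suc i))
        \<ge> (x - A (Suc i) - C (Suc i) - (1 - q ^ Suc i) * (1 - a * q ^ Suc i)) * ?g (Suc i)"
      by (simp add: algebra_simps)
    \<comment> \<open>The bound reproduces itself: at \<open>x = 1\<close> everything cancels except
      the term that the next instance of the bound requires.\<close>
    also have "x - A (Suc i) - C (Suc i) - (1 - q ^ Suc i) * (1 - a * q ^ Suc i)
        = x - 1 + q ^ Suc i * (a * q ^ Suc (Suc i))"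
      by (simp add: qL_A_def qL_C_def algebra_simps)
    also have "q ^ Suc i * (a * q ^ Suc (Suc i)) * ?g (Suc i) \<le> \<dots> * ?g (Suc i)"
      using assms pos by (intro mult_right_mono) auto
    finally have "q ^ Suc i * (a * q ^ Suc (Suc i) * ?g (Suc i))
        \<le> q ^ Suc i * ((1 - a * q ^ Suc (Suc i)) * ?g (Suc (Suc i)))"
      unfolding qL_A_def by (simp add: mult_ac)
    thus ?case using pos q_pos by (simp del: power_Suc)
  qed
  thus ?thesis by simp
qed

lemma roots_p_subset: "{x. poly (p i) x = 0} \<subseteq> {0<..<1}"
  using p_pos_of_nonpos[of _ i] p_sign_of_ge_1[of _ i] by (force simp: not_less[symmetric])

text \<open>Confluent Christoffel-Darboux: \<open>A (Suc i)\<close> times the new Wronskian is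
  \<open>C (Suc i)\<close> times the old one minus a square, so the negative sign persists. A
  multiple zero of \<open>p (Suc i)\<close> would make the Wronskian vanish.\<close>

lemma wronskian_neg:
  "poly (pderiv (p (Suc i))) x * poly (p i) x - poly (p (Suc i)) x * poly (pderiv (p i)) x < 0"
proof (induction i)
  case 0
  have "A 0 * poly (pderiv (p 1)) x = poly (pderiv (smult (A 0) (p 1))) x"
    by (simp add: pderiv_smult)
  also have "\<dots> = -1" unfolding p_1 by (simp add: pderiv_pCons)
  finally show ?case using A_pos[of 0] mult_nonneg_nonneg[of "A 0" "poly (pderiv (p 1)) x"] by force
next
  case (Suc i)
  let ?d = "\<lambda>i. poly (pderiv (p i)) x" and ?p = "\<lambda>i. poly (p i) x"
  have "A (Suc i) * ?d (Suc (Suc i)) = poly (pderiv (smult (A (Suc i)) (p (Suc (Suc i))))) x"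
    by (simp add: pderiv_smult)
  also have "\<dots> = (A (Suc i) + C (Suc i) - x) * ?d (Suc i) - ?p (Suc i) - C (Suc i) * ?d i"
    unfolding p_Suc_Suc
    by (simp add: pderiv_diff pderiv_add pderiv_minus pderiv_smult pderiv_pCons algebra_simps)
  finally have d: "A (Suc i) * ?d (Suc (Suc i))
      = (A (Suc i) + C (Suc i) - x) * ?d (Suc i) - ?p (Suc i) - C (Suc i) * ?d i" .
  have "A (Suc i) * (?d (Suc (Suc i)) * ?p (Suc i) - ?p (Suc (Suc i)) * ?d (Suc i))
      = (A (Suc i) * ?d (Suc (Suc i))) * ?p (Suc i) - (A (Suc i) * ?p (Suc (Suc i))) * ?d (Suc i)"
    by (simp add: algebra_simps)
  also have "\<dots> = C (Suc i) * (?d (Suc i) * ?p i - ?p (Suc i) * ?d i) - ?p (Suc i) * ?p (Suc i)"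
    unfolding d poly_p_Suc_Suc by (simp add: algebra_simps)
  also have "\<dots> < 0"
    using mult_pos_neg[OF C_Suc_pos[of i] Suc.IH] zero_le_square[of "?p (Suc i)"] by linarith
  finally show ?case using A_pos[of "Suc i"] by (simp add: mult_less_0_iff)
qed

lemma rsquarefree_p: "rsquarefree (p i)"
proof (cases i)
  case (Suc j)
  show ?thesis unfolding rsquarefree_roots
  proof (intro allI notI, elim conjE)
    fix x assume "poly (p i) x = 0" "poly (pderiv (p i)) x = 0"
    thus False using wronskian_neg[of j x] Suc by simp
  qed
qed (simp add: rsquarefree_roots)

text \<open>For \<open>Im z > 0\<close> the ratios \<open>p (i + 1) / p i\<close> stay in the lower half plane, and conversely.\<close>

lemma complex_p_nonzero:
  assumes "Im z \<noteq> 0"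
  shows "poly (map_poly complex_of_real (p i)) z \<noteq> 0"
proof -
  let ?p = "\<lambda>i. poly (map_poly complex_of_real (p i)) z"
  have add: "poly (map_poly complex_of_real (r - s)) z
      = poly (map_poly complex_of_real r) z - poly (map_poly complex_of_real s) z" for r s
  proof -
    have "map_poly complex_of_real (r - s) = map_poly complex_of_real r - map_poly complex_of_real s"
      by (rule poly_eqI) (simp add: coeff_map_poly)
    thus ?thesis by simp
  qed
  have smult: "poly (map_poly complex_of_real (smult c r)) z
      = of_real c * poly (map_poly complex_of_real r) z" for c r
  proof -
    have "map_poly complex_of_real (smult c r) = smult (of_real c) (map_poly complex_of_real r)"
      by (rule poly_eqI) (simp add: coeff_map_poly)
    thus ?thesis by simp
  qed
  have pCons: "poly (map_poly complex_of_real (pCons c r)) z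
      = of_real c + z * poly (map_poly complex_of_real r) z" for c r
    by (simp add: map_poly_pCons)
  have lin: "[:c, - 1:] * r = smult c r - pCons 0 r" for c :: real and r
    by simp
  have r0: "of_real (A 0) * ?p 1 = of_real (A 0) - z"
    using arg_cong[OF p_1, of "\<lambda>r. poly (map_poly complex_of_real r) z"]
    by (simp add: smult pCons)
  have rec: "of_real (A (Suc i)) * ?p (Suc (Suc i))
     = of_real (A (Suc i) + C (Suc i)) * ?p (Suc i) - z * ?p (Suc i) - of_real (C (Suc i)) * ?p i" for i
    using arg_cong[OF p_Suc_Suc[of i], of "\<lambda>r. poly (map_poly complex_of_real r) z"]
    by (simp add: smult pCons add lin del: mult_pCons_left)
  have "?p i \<noteq> 0 \<and> Im z * Im (?p (Suc i) / ?p i) < 0"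
  proof (induction i)
    case 0
    have "?p 1 = 1 - z / of_real (A 0)"
      using r0 A_pos[of 0] by (simp add: field_simps)
    moreover have "?p 0 = 1" by simp
    ultimately show ?case using assms A_pos[of 0]
      by (simp add: Im_divide_of_real) (simp add: divide_simps flip: power2_eq_square)
  next
    case (Suc i)
    define r r' where "r = ?p (Suc i) / ?p i" and "r' = ?p (Suc (Suc i)) / ?p (Suc i)"
    have ne: "?p (Suc i) \<noteq> 0" using Suc by auto
    have IH: "Im z * Im r < 0" using Suc by (simp add: r_def)
    \<comment> \<open>The recurrence divided by \<open>?p (Suc i)\<close>. Inversion reflects the
      half planes, so \<open>inverse r\<close> lies on the side of \<open>z\<close>, and both
      \<open>- z\<close> and the term with \<open>inverse r\<close> push \<open>r'\<close> to the
      other side.\<close>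
    have "of_real (A (Suc i)) * r'
        = of_real (A (Suc i) + C (Suc i)) - z - of_real (C (Suc i)) * inverse r"
      using rec[of i] ne Suc by (simp add: r_def r'_def field_simps)
    hence "Im (of_real (A (Suc i)) * r')
        = Im (of_real (A (Suc i) + C (Suc i)) - z - of_real (C (Suc i)) * inverse r)"
      by (rule arg_cong)
    hence "A (Suc i) * Im r' = - Im z + C (Suc i) * Im r / (cmod r)\<^sup>2"
      by (simp add: cmod_power2)
    hence "Im z * (A (Suc i) * Im r') = Im z * (- Im z + C (Suc i) * Im r / (cmod r)\<^sup>2)"
      by (rule arg_cong)
    hence "A (Suc i) * (Im z * Im r') = - (Im z * Im z) + C (Suc i) * (Im z * Im r) / (cmod r)\<^sup>2"
      by (simp add: algebra_simps)
    also have "\<dots> < 0"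
    proof -
      have "C (Suc i) * (Im z * Im r) \<le> 0"
        using IH C_Suc_pos[of i] mult_nonneg_nonpos[of "C (Suc i)" "Im z * Im r"] by linarith
      hence "C (Suc i) * (Im z * Im r) / (cmod r)\<^sup>2 \<le> 0"
        by (intro divide_nonpos_nonneg) auto
      moreover have "Im z * Im z > 0"
        using assms by (simp add: zero_less_mult_iff) linarith
      ultimately show ?thesis by linarith
    qed
    finally have "Im z * Im r' < 0" using A_pos[of "Suc i"] by (simp add: mult_less_0_iff)
    thus ?case using ne by (simp add: r'_def)
  qed
  thus ?thesis by simp
qed

lemma card_roots_p: "card {x. poly (p i) x = 0} = i"
proof -
  have "card {x. poly (p i) x = 0} = degree (p i)"
  proof (rule card_real_roots_eq_degree)
    fix z assume "poly (map_poly complex_of_real (p i)) z = 0"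
    thus "z \<in> \<real>" using complex_p_nonzero[of z i] complex_is_Real_iff by blast
  qed (rule rsquarefree_p)
  thus ?thesis by (simp add: degree_p)
qed

lemma zero_counting_integral_p:
  "zero_counting_integral i (p i) f = (1 / real i) * (\<Sum>x | poly (p i) x = 0. f x)"
proof -
  have "p i \<noteq> 0" using rsquarefree_p[of i] by (simp add: rsquarefree_def)
  thus ?thesis unfolding zero_counting_integral_def
    by (intro arg_cong[of _ _ "\<lambda>t. _ * t"] sum.cong) (auto simp: rsquarefree_root_order[OF rsquarefree_p])
qed

end

section \<open>Slowly varying Jacobi coefficients\<close>

definition lim_A :: "real \<Rightarrow> real \<Rightarrow> real" where "lim_A w u = u * (1 - w * u)"
definition lim_C :: "real \<Rightarrow> real \<Rightarrow> real" where "lim_C w u = w * u * (1 - u)"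
definition lim_D :: "real \<Rightarrow> real \<Rightarrow> real" where "lim_D w u = lim_A w u + lim_C w u"
definition lim_B :: "real \<Rightarrow> real \<Rightarrow> real" where "lim_B w u = sqrt (lim_A w u * lim_C w u)"
definition lim_symbol :: "real \<Rightarrow> real \<Rightarrow> real \<Rightarrow> real" where
  "lim_symbol w u \<theta> = lim_D w u - 2 * lim_B w u * cos \<theta>"

text \<open>The \<open>m\<close>-th off-diagonal entry of the \<open>k\<close>-th power of the bi-infinite Toeplitz matrix
  with symbol \<open>lim_symbol w u\<close>.\<close>

definition toeplitz_power :: "real \<Rightarrow> nat \<Rightarrow> real \<Rightarrow> int \<Rightarrow> real" where
  "toeplitz_power w k u m = (1 / pi) * integral {0..pi} (\<lambda>\<theta>. lim_symbol w u \<theta> ^ k * cos (of_int m * \<theta>))"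

lemma continuous_on_lim_symbol: "continuous_on T (lim_symbol w u)"
  unfolding lim_symbol_def by (intro continuous_intros)

lemma continuous_on_lim_D: "continuous_on T (lim_D w)"
  unfolding lim_D_def lim_A_def lim_C_def by (intro continuous_intros)

lemma continuous_on_lim_B: "continuous_on T (lim_B w)"
  unfolding lim_B_def lim_A_def lim_C_def by (intro continuous_intros)

lemma toeplitz_integrable:
  "(\<lambda>\<theta>. lim_symbol w u \<theta> ^ k * cos (of_int m * \<theta>)) integrable_on {0..pi}"
  by (intro integrable_continuous_real continuous_intros continuous_on_lim_symbol)

lemma toeplitz_power_0: "toeplitz_power w 0 u m = of_bool (m = 0)"
proof (cases "m = 0")
  case False
  have "((\<lambda>\<theta>. cos (of_int m * \<theta>)) has_integral
      (sin (of_int m * pi) / of_int m - sin (of_int m * 0) / of_int m)) {0..pi}"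
    by (rule fundamental_theorem_of_calculus)
      (use False in \<open>auto intro!: derivative_eq_intros simp flip: has_real_derivative_iff_has_vector_derivative\<close>)
  moreover have "sin (real_of_int m * pi) = 0"
    by (simp add: sin_zero_iff_int2)
  ultimately have "((\<lambda>\<theta>. cos (of_int m * \<theta>)) has_integral 0) {0..pi}" by simp
  thus ?thesis using False by (simp add: toeplitz_power_def integral_unique)
qed (simp add: toeplitz_power_def)

text \<open>By \<open>2 cos \<theta> cos (m \<theta>) = cos ((m - 1) \<theta>) + cos ((m + 1)
  \<theta>)\<close>. This mirrors the recursion of \<open>jacobi_power\<close>, so the two can be
  compared by induction on \<open>k\<close>.\<close>

lemma toeplitz_power_Suc:
  "toeplitz_power w (Suc k) u m = lim_D w u * toeplitz_power w k u m
     - lim_B w u * (toeplitz_power w k u (m - 1) + toeplitz_power w k u (m + 1))"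
proof -
  let ?f = "\<lambda>m \<theta>. lim_symbol w u \<theta> ^ k * cos (of_int m * \<theta>)"
  have "lim_symbol w u \<theta> ^ Suc k * cos (of_int m * \<theta>)
      = lim_D w u * ?f m \<theta> - lim_B w u * (?f (m - 1) \<theta> + ?f (m + 1) \<theta>)" for \<theta>
  proof -
    have "?f (m - 1) \<theta> + ?f (m + 1) \<theta> = 2 * cos \<theta> * ?f m \<theta>"
      by (simp add: distrib_right left_diff_distrib cos_add cos_diff algebra_simps)
    thus ?thesis by (simp add: lim_symbol_def algebra_simps)
  qed
  hence "integral {0..pi} (\<lambda>\<theta>. lim_symbol w u \<theta> ^ Suc k * cos (of_int m * \<theta>))
      = integral {0..pi} (\<lambda>\<theta>. lim_D w u * ?f m \<theta> - lim_B w u * (?f (m - 1) \<theta> + ?f (m + 1) \<theta>))"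
    by presburger
  also have "\<dots> = lim_D w u * integral {0..pi} (?f m)
      - lim_B w u * (integral {0..pi} (?f (m - 1)) + integral {0..pi} (?f (m + 1)))"
    by (subst integral_diff)
      (auto intro!: integrable_continuous_real continuous_intros continuous_on_lim_symbol
        simp: integral_add toeplitz_integrable simp del: of_int_add of_int_diff)
  finally have eq: "integral {0..pi} (\<lambda>\<theta>. lim_symbol w u \<theta> ^ Suc k * cos (of_int m * \<theta>))
      = lim_D w u * integral {0..pi} (?f m)
        - lim_B w u * (integral {0..pi} (?f (m - 1)) + integral {0..pi} (?f (m + 1)))" .
  show ?thesis
    unfolding toeplitz_power_def eq by (simp only: ring_distribs mult_ac)
qed

text \<open>With a general \<open>f\<close> it covers both a power of the symbol and a difference of
  two such powers; the bound is uniform in \<open>m\<close>.\<close>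

lemma abs_toeplitz_le:
  assumes "continuous_on {0..pi} f" "\<And>\<theta>. \<theta> \<in> {0..pi} \<Longrightarrow> \<bar>f \<theta>\<bar> \<le> e"
  shows "\<bar>(1 / pi) * integral {0..pi} (\<lambda>\<theta>. f \<theta> * cos (of_int m * \<theta>))\<bar> \<le> e"
proof -
  have "norm (integral {0..pi} (\<lambda>\<theta>. f \<theta> * cos (of_int m * \<theta>))) \<le> e * (pi - 0)"
  proof (rule integral_bound)
    show "continuous_on {0..pi} (\<lambda>\<theta>. f \<theta> * cos (of_int m * \<theta>))"
      by (intro continuous_intros assms)
    fix t assume t: "t \<in> {0..pi}"
    have "\<bar>f t\<bar> * \<bar>cos (of_int m * t)\<bar> \<le> e * 1"
      using assms(2)[OF t] by (intro mult_mono) auto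
    thus "norm (f t * cos (of_int m * t)) \<le> e" by (simp add: abs_mult)
  qed auto
  thus ?thesis by (simp add: abs_mult field_simps)
qed

text \<open>The size bounds sit on one limiting factor \<open>x'\<close> and one perturbed factor
  \<open>y\<close>, as in the induction below: limiting coefficients are at most 1, perturbed matrix
  entries at most 2.\<close>

lemma perturb_mult:
  fixes x y x' y' :: real
  assumes "\<bar>x - x'\<bar> \<le> d" "\<bar>y - y'\<bar> \<le> e" "\<bar>x'\<bar> \<le> 1" "\<bar>y\<bar> \<le> M" 
  shows "\<bar>x * y - x' * y'\<bar> \<le> M * d + e"
proof -
  have "x * y - x' * y' = y * (x - x') + x' * (y - y')" by (simp add: algebra_simps)
  also have "\<bar>\<dots>\<bar> \<le> \<bar>y\<bar> * \<bar>x - x'\<bar> + \<bar>x'\<bar> * \<bar>y - y'\<bar>"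
    by (metis abs_triangle_ineq abs_mult)
  also have "\<dots> \<le> M * d + 1 * e"
    using assms by (intro add_mono mult_mono) auto
  finally show ?thesis by simp
qed

section \<open>Bounds and continuity for the limiting model\<close>

locale lim_params =
  fixes w :: real
  assumes w_pos: "0 < w" and w_le_1: "w \<le> 1"
begin

lemma lim_A_bounds: "u \<in> {0..1} \<Longrightarrow> lim_A w u \<in> {0..1}"
  using w_pos w_le_1 mult_le_one[of w u] mult_le_one[of u "1 - w * u"] by (auto simp: lim_A_def)

lemma lim_C_bounds: "u \<in> {0..1} \<Longrightarrow> lim_C w u \<in> {0..1}"
  using w_pos w_le_1 mult_le_one[of w u] mult_le_one[of "w * u" "1 - u"] by (auto simp: lim_C_def)

lemma lim_B_nonneg: "u \<in> {0..1} \<Longrightarrow> lim_B w u \<ge> 0"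
  using lim_A_bounds[of u] lim_C_bounds[of u] by (simp add: lim_B_def)

lemma lim_D_minus_lim_B: 
  assumes "u \<in> {0..1}" shows "lim_D w u - 2 * lim_B w u = (sqrt (lim_A w u) - sqrt (lim_C w u))\<^sup>2"
  using lim_A_bounds[OF assms] lim_C_bounds[OF assms]
  by (simp add: lim_D_def lim_B_def power2_diff real_sqrt_mult)

text \<open>The product \<open>lim_A w u * lim_C w u\<close> also splits as
  \<open>(u\<^sup>2 * w) * ((1 - u) * (1 - w * u))\<close>, which completes the square. It keeps the
  range of the symbol below 1, and at \<open>u = s\<close> it supplies the roots of
  \<open>1 - a\<close> and \<open>1 - b\<close> in the density.\<close>

lemma one_minus_lim_D_plus_lim_B:
  assumes "u \<in> {0..1}"
  shows "1 - (lim_D w u + 2 * lim_B w u) = (u * sqrt w - sqrt ((1 - u) * (1 - w * u)))\<^sup>2"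
proof -
  have "w * u \<le> 1" using assms w_le_1 w_pos by (simp add: mult_le_one)
  hence nn: "(1 - u) * (1 - w * u) \<ge> 0" using assms by simp
  have "lim_B w u = sqrt ((u\<^sup>2 * w) * ((1 - u) * (1 - w * u)))"
    unfolding lim_B_def lim_A_def lim_C_def by (rule arg_cong) (simp add: power2_eq_square algebra_simps)
  also have "\<dots> = u * sqrt w * sqrt ((1 - u) * (1 - w * u))"
    using assms by (simp add: real_sqrt_mult)
  finally have B: "lim_B w u = u * sqrt w * sqrt ((1 - u) * (1 - w * u))" .
  show ?thesis
    unfolding B power2_diff power_mult_distrib real_sqrt_pow2[OF nn] lim_D_def lim_A_def lim_C_def
    using w_pos by (simp add: power2_eq_square algebra_simps)
qed

lemma one_minus_lim_D_minus_lim_B: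
  assumes "u \<in> {0..1}"
  shows "1 - (lim_D w u - 2 * lim_B w u) = (u * sqrt w + sqrt ((1 - u) * (1 - w * u)))\<^sup>2"
proof -
  have *: "(x + y)\<^sup>2 = (x - y)\<^sup>2 + 4 * (x * y)" for x y :: real
    by (simp add: power2_eq_square algebra_simps)
  have "lim_B w u = sqrt ((u\<^sup>2 * w) * ((1 - u) * (1 - w * u)))"
    unfolding lim_B_def lim_A_def lim_C_def by (rule arg_cong) (simp add: power2_eq_square algebra_simps)
  also have "\<dots> = u * sqrt w * sqrt ((1 - u) * (1 - w * u))"
    using assms by (simp add: real_sqrt_mult)
  finally show ?thesis
    unfolding * one_minus_lim_D_plus_lim_B[OF assms, symmetric] by simp
qed

lemma lim_D_lim_B_bounds:
  assumes "u \<in> {0..1}"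
  shows "2 * lim_B w u \<le> lim_D w u" "lim_D w u + 2 * lim_B w u \<le> 1"
proof -
  show "2 * lim_B w u \<le> lim_D w u"
    using lim_D_minus_lim_B[OF assms] zero_le_power2[of "sqrt (lim_A w u) - sqrt (lim_C w u)"] by linarith
  show "lim_D w u + 2 * lim_B w u \<le> 1"
    using one_minus_lim_D_plus_lim_B[OF assms] zero_le_power2[of "u * sqrt w - sqrt ((1 - u) * (1 - w * u))"] by linarith
qed

lemma lim_symbol_bounds:
  assumes "u \<in> {0..1}"
  shows "lim_symbol w u \<theta> \<in> {0..1}"
proof -
  have "\<bar>2 * lim_B w u * cos \<theta>\<bar> \<le> 2 * lim_B w u * 1"
    unfolding abs_mult using lim_B_nonneg[OF assms] by (intro mult_mono) auto
  thus ?thesis using lim_D_lim_B_bounds[OF assms] 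
    unfolding lim_symbol_def atLeastAtMost_iff by linarith
qed

lemma abs_toeplitz_power_le_1:
  assumes "u \<in> {0..1}"
  shows "\<bar>toeplitz_power w k u m\<bar> \<le> 1"
  unfolding toeplitz_power_def
proof (rule abs_toeplitz_le)
  show "\<bar>lim_symbol w u \<theta> ^ k\<bar> \<le> 1" for \<theta>
    using lim_symbol_bounds[OF assms, of \<theta>] by (simp add: power_abs power_le_one)
qed (intro continuous_intros continuous_on_lim_symbol)

text \<open>Uniformity in \<open>m\<close> matters, since \<open>m\<close> will be the difference of
  a column and a row index and is unbounded.\<close>

lemma toeplitz_power_uniformly_continuous:
  assumes "e > 0"
  shows "\<exists>\<delta>>0. \<forall>u\<in>{0..1}. \<forall>v\<in>{0..1}. \<bar>u - v\<bar> < \<delta> \<longrightarrow>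
           (\<forall>m. \<bar>toeplitz_power w k u m - toeplitz_power w k v m\<bar> \<le> e)"
proof -
  \<comment> \<open>The 3 collects one error of \<open>lim_D\<close> and two of
    \<open>lim_B\<close>; \<open>k\<close> is the Lipschitz constant of the power on
    \<open>[0, 1]\<close>, and the added 1 covers \<open>k = 0\<close>.\<close>
  define e' where "e' = e / (3 * (real k + 1))"
  have e': "e' > 0" using assms by (simp add: e'_def)
  have "uniformly_continuous_on {0..1} (lim_D w)" "uniformly_continuous_on {0..1} (lim_B w)"
    by (auto intro!: compact_uniformly_continuous continuous_on_lim_D continuous_on_lim_B)
  then obtain \<delta>1 \<delta>2 where \<delta>: "\<delta>1 > 0" "\<delta>2 > 0"
    "\<And>u v. u \<in> {0..1} \<Longrightarrow> v \<in> {0..1} \<Longrightarrow> dist v u < \<delta>1 \<Longrightarrow> dist (lim_D w v) (lim_D w u) < e'"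
    "\<And>u v. u \<in> {0..1} \<Longrightarrow> v \<in> {0..1} \<Longrightarrow> dist v u < \<delta>2 \<Longrightarrow> dist (lim_B w v) (lim_B w u) < e'"
    using e' unfolding uniformly_continuous_on_def by metis
  show ?thesis
  proof (intro exI[of _ "min \<delta>1 \<delta>2"] conjI ballI impI allI)
    fix u v :: real and m :: int
    assume u: "u \<in> {0..1}" and v: "v \<in> {0..1}" and uv: "\<bar>u - v\<bar> < min \<delta>1 \<delta>2"
    have D: "\<bar>lim_D w u - lim_D w v\<bar> \<le> e'" and B: "\<bar>lim_B w u - lim_B w v\<bar> \<le> e'"
      using \<delta>(3)[of v u] \<delta>(4)[of v u] u v uv by (auto simp: dist_real_def)
    have diff: "\<bar>lim_symbol w u \<theta> ^ k - lim_symbol w v \<theta> ^ k\<bar> \<le> e" for \<theta>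
    proof -
      have "\<bar>(lim_B w u - lim_B w v) * cos \<theta>\<bar> \<le> e' * 1"
        unfolding abs_mult using B e' by (intro mult_mono) auto
      hence "\<bar>lim_symbol w u \<theta> - lim_symbol w v \<theta>\<bar> \<le> 3 * e'"
        using D unfolding lim_symbol_def by (simp add: algebra_simps abs_le_iff)
      moreover have "norm (lim_symbol w u \<theta> ^ k - lim_symbol w v \<theta> ^ k)
          \<le> real k * norm (lim_symbol w u \<theta> - lim_symbol w v \<theta>)"
        using lim_symbol_bounds[OF u, of \<theta>] lim_symbol_bounds[OF v, of \<theta>]
        by (intro norm_power_diff) auto
      ultimately have "\<bar>lim_symbol w u \<theta> ^ k - lim_symbol w v \<theta> ^ k\<bar> \<le> real k * (3 * e')"
        by (smt (verit) mult_left_mono of_nat_0_le_iff real_norm_def)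
      also have "\<dots> \<le> e" using assms unfolding e'_def by (simp add: field_simps)
      finally show ?thesis .
    qed
    have "toeplitz_power w k u m - toeplitz_power w k v m
        = (1 / pi) * integral {0..pi} (\<lambda>\<theta>. (lim_symbol w u \<theta> ^ k - lim_symbol w v \<theta> ^ k) * cos (of_int m * \<theta>))"
      unfolding toeplitz_power_def
      by (simp add: left_diff_distrib integral_diff toeplitz_integrable right_diff_distrib diff_divide_distrib)
    also have "\<bar>\<dots>\<bar> \<le> e"
      by (rule abs_toeplitz_le) (use diff in \<open>auto intro!: continuous_intros continuous_on_lim_symbol\<close>)
    finally show "\<bar>toeplitz_power w k u m - toeplitz_power w k v m\<bar> \<le> e" .
  qed (use \<delta> in auto)
qed

lemma continuous_on_toeplitz_power: "continuous_on {0..1} (\<lambda>u. toeplitz_power w k u m)"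
  unfolding continuous_on_iff
proof (intro ballI allI impI)
  fix u e :: real assume u: "u \<in> {0..1}" and e: "e > 0"
  obtain \<delta> where \<delta>: "\<delta> > 0" "\<forall>u\<in>{0..1}. \<forall>v\<in>{0..1}. \<bar>u - v\<bar> < \<delta> \<longrightarrow>
           (\<forall>m. \<bar>toeplitz_power w k u m - toeplitz_power w k v m\<bar> \<le> e / 2)"
    using toeplitz_power_uniformly_continuous[of "e / 2" k] e by auto
  show "\<exists>d>0. \<forall>x'\<in>{0..1}. dist x' u < d \<longrightarrow> dist (toeplitz_power w k x' m) (toeplitz_power w k u m) < e"
  proof (intro exI[of _ \<delta>] conjI ballI impI)
    fix v assume "v \<in> {0..1}" "dist v u < \<delta>"
    hence "\<bar>toeplitz_power w k v m - toeplitz_power w k u m\<bar> \<le> e / 2"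
      using \<delta>(2) u by (simp add: dist_real_def)
    thus "dist (toeplitz_power w k v m) (toeplitz_power w k u m) < e"
      using e by (simp add: dist_real_def)
  qed (rule \<delta>(1))
qed

text \<open>Induction on \<open>k\<close>. Row \<open>i\<close> refers to its neighbours, where the
  model is evaluated at a neighbouring power of \<open>q\<close>; uniform continuity moves it back
  to \<open>q ^ i\<close>. The entry \<open>b i\<close> belongs to the rows \<open>i\<close> and
  \<open>Suc i\<close>, so it is compared with \<open>lim_B\<close> at both powers.\<close>

lemma jacobi_power_approx:
  assumes "e > 0"
  shows "\<exists>\<delta>>0. \<forall>d b q. 0 < q \<and> q < 1 \<and> 1 - q < \<delta> \<and>
           (\<forall>i. \<bar>d i - lim_D w (q ^ i)\<bar> \<le> \<delta>) \<and> (\<forall>i. \<bar>b i + lim_B w (q ^ i)\<bar> \<le> \<delta>) \<and>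
           (\<forall>i. \<bar>b i + lim_B w (q ^ Suc i)\<bar> \<le> \<delta>) \<longrightarrow>
           (\<forall>i l. \<bar>jacobi_power d b k i l - toeplitz_power w k (q ^ i) (int l - int i)\<bar> \<le> e)"
  using assms
proof (induction k arbitrary: e)
  case 0
  thus ?case by (intro exI[of _ 1]) (auto simp: toeplitz_power_0)
next
  case (Suc k)
  \<comment> \<open>The three products contribute at most \<open>6 * \<delta> + 5 * e'\<close>,
    whence \<open>e / 12\<close> and \<open>e / 10\<close>; \<open>e' \<le> 1/2\<close> keeps the
    approximated entries below 2.\<close>
  define e' where "e' = min (1/2) (e / 10)"
  have e': "e' > 0" "e' \<le> 1/2" "e' \<le> e / 10" using Suc.prems by (auto simp: e'_def)
  obtain \<delta>1 where \<delta>1: "\<delta>1 > 0" and approx: "\<And>d b q. 0 < q \<Longrightarrow> q < 1 \<Longrightarrow> 1 - q < \<delta>1 \<Longrightarrow>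
           (\<forall>i. \<bar>d i - lim_D w (q ^ i)\<bar> \<le> \<delta>1) \<Longrightarrow> (\<forall>i. \<bar>b i + lim_B w (q ^ i)\<bar> \<le> \<delta>1) \<Longrightarrow>
           (\<forall>i. \<bar>b i + lim_B w (q ^ Suc i)\<bar> \<le> \<delta>1) \<Longrightarrow>
           (\<forall>i l. \<bar>jacobi_power d b k i l - toeplitz_power w k (q ^ i) (int l - int i)\<bar> \<le> e')"
    using Suc.IH[OF e'(1)] by meson
  obtain \<delta>2 where \<delta>2: "\<delta>2 > 0" and uc: "\<And>u v m. u \<in> {0..1} \<Longrightarrow> v \<in> {0..1} \<Longrightarrow> \<bar>u - v\<bar> < \<delta>2 \<Longrightarrow>
           \<bar>toeplitz_power w k u m - toeplitz_power w k v m\<bar> \<le> e'"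
    using toeplitz_power_uniformly_continuous[OF e'(1)] by meson
  define \<delta> where "\<delta> = min (e / 12) (min \<delta>1 \<delta>2)"
  have \<delta>: "\<delta> > 0" "\<delta> \<le> e / 12" "\<delta> \<le> \<delta>1" "\<delta> \<le> \<delta>2" using Suc.prems \<delta>1 \<delta>2 by (auto simp: \<delta>_def)
  show ?case
  proof (intro exI[of _ \<delta>] conjI allI impI, fact \<delta>(1), elim conjE)
    fix d b :: "nat \<Rightarrow> real" and q :: real and i l :: nat
    assume q: "0 < q" "q < 1" "1 - q < \<delta>" and D: "\<forall>i. \<bar>d i - lim_D w (q ^ i)\<bar> \<le> \<delta>"
      and B: "\<forall>i. \<bar>b i + lim_B w (q ^ i)\<bar> \<le> \<delta>" and B': "\<forall>i. \<bar>b i + lim_B w (q ^ Suc i)\<bar> \<le> \<delta>"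
    let ?J = "jacobi_power d b k" and ?T = "toeplitz_power w k" and ?u = "q ^ i" and ?m = "int l - int i"
    have J: "\<bar>?J i l - ?T (q ^ i) (int l - int i)\<bar> \<le> e'" for i
      using approx[of q d b] q D B B' \<delta> by (meson order.strict_trans2 order.trans)
    have q01: "q ^ i \<in> {0..1}" for i using q by (auto intro!: power_le_one)
    have near: "\<bar>q ^ Suc i - q ^ i\<bar> < \<delta>2" for i
    proof -
      have "\<bar>q ^ Suc i - q ^ i\<bar> = q ^ i * (1 - q)" using q by (simp add: abs_if algebra_simps)
      also have "\<dots> \<le> 1 * (1 - q)" using q q01[of i] by (intro mult_right_mono) auto
      also have "\<dots> < \<delta>2" using q \<delta> by simp
      finally show ?thesis .
    qed
    have T1: "\<bar>?T u m\<bar> \<le> 1" if "u \<in> {0..1}" for u m using abs_toeplitz_power_le_1[OF that] .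
    have J2: "\<bar>?J i l\<bar> \<le> 2" for i using J[of i] T1[OF q01[of i], of "int l - int i"] e' by linarith
    have DB1: "\<bar>lim_D w ?u\<bar> \<le> 1" "\<bar>lim_B w ?u\<bar> \<le> 1"
      using lim_D_lim_B_bounds[OF q01[of i]] lim_B_nonneg[OF q01[of i]] by auto
    have t1: "\<bar>d i * ?J i l - lim_D w ?u * ?T ?u ?m\<bar> \<le> 2 * \<delta> + e'"
      by (rule perturb_mult) (use D J J2 DB1 in auto)
    \<comment> \<open>The induction hypothesis concerns \<open>q ^ Suc i\<close>; passing to
      \<open>?u\<close> costs a second \<open>e'\<close>.\<close>
    have "int l - int (Suc i) = ?m - 1" by simp
    hence "\<bar>?J (Suc i) l - ?T ?u (?m - 1)\<bar> \<le> 2 * e'"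
      using J[of "Suc i"] uc[OF q01[of "Suc i"] q01[of i] near, of "?m - 1"] by (simp only: abs_le_iff) linarith
    hence t2: "\<bar>b i * ?J (Suc i) l - (- lim_B w ?u) * ?T ?u (?m - 1)\<bar> \<le> 2 * \<delta> + 2 * e'"
      by (intro perturb_mult) (use B J2 DB1 in auto)
    have T: "toeplitz_power w (Suc k) ?u ?m = lim_D w ?u * ?T ?u ?m + (- lim_B w ?u) * ?T ?u (?m - 1)
        + (- lim_B w ?u) * ?T ?u (?m + 1)"
      unfolding toeplitz_power_Suc by (simp add: algebra_simps)
    show "\<bar>jacobi_power d b (Suc k) i l - toeplitz_power w (Suc k) ?u ?m\<bar> \<le> e"
    proof (cases i)
      case 0
      \<comment> \<open>In the top row \<open>?u = 1\<close>: the model has zero coupling to the row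
        above, which the Jacobi matrix lacks.\<close>
      have "lim_B w ?u = 0" using 0 by (simp add: lim_B_def lim_C_def)
      thus ?thesis unfolding T using t1 t2 e' \<delta> 0 by (simp add: abs_le_iff)
    next
      case (Suc j)
      have "int l - int j = ?m + 1" using Suc by simp
      hence "\<bar>?J j l - ?T ?u (?m + 1)\<bar> \<le> 2 * e'"
        using J[of j] uc[OF q01[of "Suc j"] q01[of j] near, of "?m + 1"] Suc by (simp only: abs_le_iff) linarith
      hence t3: "\<bar>b j * ?J j l - (- lim_B w ?u) * ?T ?u (?m + 1)\<bar> \<le> 2 * \<delta> + 2 * e'"
        by (intro perturb_mult) (use B' J2 DB1 Suc in auto)
      have "jacobi_power d b (Suc k) i l = d i * ?J i l + b i * ?J (Suc i) l + b j * ?J j l"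
        using Suc by simp
      thus ?thesis unfolding T using t1 t2 t3 e'(3) \<delta>(2) by linarith
    qed
  qed
qed

end

text \<open>The sum has \<open>n\<close> terms with mesh \<open>1 / N\<close>, so it approximates
  the integral up to \<open>n / N\<close>, which may exceed 1; hence continuity beyond 1 is
  assumed.\<close>

lemma riemann_sum_tendsto:
  fixes H :: "real \<Rightarrow> real" and n N :: "nat \<Rightarrow> nat"
  assumes cont: "continuous_on {0..} H"
    and n: "filterlim n at_top sequentially" and N: "filterlim N at_top sequentially"
    and nN: "(\<lambda>k. real (n k) / real (N k)) \<longlonglongrightarrow> 1"
  shows "(\<lambda>k. (1 / real (n k)) * (\<Sum>i<n k. H (real i / real (N k)))) \<longlonglongrightarrow> integral {0..1} H"
proof -
  have int: "H integrable_on {x..y}" if "0 \<le> x" for x y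
    using that by (intro integrable_continuous_real continuous_on_subset[OF cont]) auto
  have step: "\<bar>(\<Sum>i<n. H (real i / M)) / M - integral {0..real n / M} H\<bar> \<le> e * (real n / M)"
    if M: "M > 0" and e: "e \<ge> 0"
      and uc: "\<And>x y. 0 \<le> x \<Longrightarrow> x \<le> y \<Longrightarrow> y \<le> x + 1 / M \<Longrightarrow> y \<le> real n / M \<Longrightarrow> \<bar>H y - H x\<bar> \<le> e"
    for M e :: real and n :: nat
    \<comment> \<open>The modulus hypothesis depends on \<open>n\<close> through its upper limit, so
      it takes part in the induction.\<close>
    using uc
  proof (induction n)
    case (Suc n)
    let ?x = "real n / M" and ?y = "real (Suc n) / M"
    have xy: "0 \<le> ?x" "?x \<le> ?y" "?y = ?x + 1 / M" using M by (auto simp: field_simps)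
    have IH: "\<bar>(\<Sum>i<n. H (real i / M)) / M - integral {0..?x} H\<bar> \<le> e * ?x"
      using Suc.IH Suc.prems xy by (meson order.trans)
    have "norm (integral {?x..?y} (\<lambda>t. H t - H ?x)) \<le> e * (?y - ?x)"
    proof (rule integral_bound)
      show "continuous_on {?x..?y} (\<lambda>t. H t - H ?x)"
        using xy by (intro continuous_intros continuous_on_subset[OF cont]) auto
      show "norm (H t - H ?x) \<le> e" if "t \<in> {?x..?y}" for t
        using Suc.prems[of ?x t] that xy by auto
    qed (use xy in auto)
    also have "integral {?x..?y} (\<lambda>t. H t - H ?x) = integral {?x..?y} H - H ?x * (?y - ?x)"
      using xy int by (subst integral_diff) auto
    finally have "\<bar>integral {?x..?y} H - H ?x / M\<bar> \<le> e / M" using xy by simp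
    moreover have "integral {0..?y} H = integral {0..?x} H + integral {?x..?y} H"
      using xy int[of 0 ?y] by (intro Henstock_Kurzweil_Integration.integral_combine[symmetric]) auto
    moreover have "(\<Sum>i<Suc n. H (real i / M)) / M = (\<Sum>i<n. H (real i / M)) / M + H ?x / M"
      by (simp add: add_divide_distrib)
    moreover have "e * ?y = e * ?x + e / M" by (simp add: add_divide_distrib algebra_simps)
    ultimately show ?case using IH by linarith
  qed auto
  have ev2: "eventually (\<lambda>k. real (n k) / real (N k) < 2) sequentially"
    using order_tendstoD(2)[OF nN, of 2] by simp
  have evN: "eventually (\<lambda>k. N k > 0) sequentially"
    using N[unfolded filterlim_at_top, rule_format, of 1] by eventually_elim simp
  have "(\<lambda>k. (\<Sum>i<n k. H (real i / real (N k))) / real (N k) - integral {0..real (n k) / real (N k)} H) \<longlonglongrightarrow> 0"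
  proof (rule tendstoI)
    fix e :: real assume e: "e > 0"
    \<comment> \<open>Eventually \<open>n / N < 2\<close>, so a fixed compact interval contains all
      nodes.\<close>
    have "uniformly_continuous_on {0..2} H"
      by (intro compact_uniformly_continuous continuous_on_subset[OF cont]) auto
    then obtain \<delta> where \<delta>: "\<delta> > 0" and uc: "\<And>x y. x \<in> {0..2} \<Longrightarrow> y \<in> {0..2} \<Longrightarrow> dist y x < \<delta> \<Longrightarrow> dist (H y) (H x) < e / 4"
      unfolding uniformly_continuous_on_def using e by (metis zero_less_divide_iff zero_less_numeral)
    have "filterlim (\<lambda>k. real (N k)) at_top sequentially"
      by (rule filterlim_compose[OF filterlim_real_sequentially N])
    hence "(\<lambda>k. 1 / real (N k)) \<longlonglongrightarrow> 0"
      by (intro tendsto_divide_0[OF tendsto_const] filterlim_at_top_imp_at_infinity)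
    hence "eventually (\<lambda>k. 1 / real (N k) < \<delta>) sequentially"
      using order_tendstoD(2) \<delta> by blast
    thus "eventually (\<lambda>k. dist ((\<Sum>i<n k. H (real i / real (N k))) / real (N k) - integral {0..real (n k) / real (N k)} H) 0 < e) sequentially"
      using ev2 evN
    proof eventually_elim
      case (elim k)
      have "\<bar>(\<Sum>i<n k. H (real i / real (N k))) / real (N k) - integral {0..real (n k) / real (N k)} H\<bar>
          \<le> e / 4 * (real (n k) / real (N k))"
      proof (rule step)
        fix x y :: real assume "0 \<le> x" "x \<le> y" "y \<le> x + 1 / real (N k)" "y \<le> real (n k) / real (N k)"
        thus "\<bar>H y - H x\<bar> \<le> e / 4"
          using uc[of x y] elim by (auto simp: dist_real_def)
      qed (use elim e in auto)
      also have "\<dots> \<le> e / 4 * 2" using elim e by (intro mult_left_mono) auto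
      also have "\<dots> < e" using e by simp
      finally show ?case by simp
    qed
  qed
  moreover have "(\<lambda>k. integral {0..real (n k) / real (N k)} H) \<longlonglongrightarrow> integral {0..1} H"
  proof -
    have "continuous_on {0..2} (\<lambda>t. integral {0..t} H)"
      by (rule indefinite_integral_continuous_1) (rule int, simp)
    moreover have "eventually (\<lambda>k. real (n k) / real (N k) \<in> {0..2}) sequentially"
      using ev2 by eventually_elim auto
    ultimately show ?thesis
      by (intro continuous_on_tendsto_compose[OF _ nN]) auto
  qed
  ultimately have "(\<lambda>k. (\<Sum>i<n k. H (real i / real (N k))) / real (N k)) \<longlonglongrightarrow> 0 + integral {0..1} H"
    using tendsto_add by fastforce
  \<comment> \<open>Dividing by \<open>n / N\<close> exchanges the prefactor \<open>1 / N\<close>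
    for \<open>1 / n\<close>.\<close>
  hence "(\<lambda>k. ((\<Sum>i<n k. H (real i / real (N k))) / real (N k)) / (real (n k) / real (N k)))
      \<longlonglongrightarrow> (0 + integral {0..1} H) / 1"
    by (rule tendsto_divide[OF _ nN]) simp
  hence "(\<lambda>k. ((\<Sum>i<n k. H (real i / real (N k))) / real (N k)) / (real (n k) / real (N k)))
      \<longlonglongrightarrow> integral {0..1} H"
    by simp
  thus ?thesis
    by (rule Lim_transform_eventually) (use evN in \<open>eventually_elim, simp\<close>)
qed

section \<open>Moments of the q-deformed Marchenko-Pastur law\<close>

text \<open>The arc cosine of \<open>- y\<close>, with \<open>y\<close> clamped to
  \<open>[-1, 1]\<close>, in the half-angle form in which the density is stated.\<close>

definition angle_of :: "real \<Rightarrow> real" where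
  "angle_of y = (if y \<le> -1 then 0 else if y \<ge> 1 then pi else 2 * arctan (sqrt ((1 + y) / (1 - y))))"

lemma emeasure_cos_ge:
  "emeasure lborel {\<theta> \<in> {0..pi}. - cos \<theta> \<le> y} = ennreal (angle_of y)"
proof -
  consider "y \<le> -1" | "y \<ge> 1" | "-1 < y" "y < 1" by linarith
  thus ?thesis
  proof cases
    case 1
    have "{\<theta> \<in> {0..pi}. - cos \<theta> \<le> y} \<subseteq> {0}"
    proof
      fix \<theta> assume \<theta>: "\<theta> \<in> {\<theta> \<in> {0..pi}. - cos \<theta> \<le> y}"
      hence "cos \<theta> = cos 0" using 1 cos_le_one[of \<theta>] by (auto simp del: cos_le_one)
      thus "\<theta> \<in> {0}" using \<theta> cos_inj_pi[of \<theta> 0] by auto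
    qed
    hence "emeasure lborel {\<theta> \<in> {0..pi}. - cos \<theta> \<le> y} \<le> emeasure lborel {0::real}"
      by (intro emeasure_mono) auto
    thus ?thesis using 1 by (simp add: angle_of_def)
  next
    case 2
    have "- cos \<theta> \<le> y" for \<theta> using 2 cos_ge_minus_one[of \<theta>] by linarith
    hence "{\<theta> \<in> {0..pi}. - cos \<theta> \<le> y} = {0..pi}" by auto
    thus ?thesis using 2 by (simp add: angle_of_def)
  next
    case 3
    define \<tau> where "\<tau> = sqrt ((1 + y) / (1 - y))"
    have \<tau>: "\<tau> \<ge> 0" "\<tau>\<^sup>2 = (1 + y) / (1 - y)" using 3 by (auto simp: \<tau>_def)
    have "cos (2 * arctan \<tau>) = (1 - \<tau>\<^sup>2) / (1 + \<tau>\<^sup>2)"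
      by (subst cos_tan_half) (auto simp: tan_arctan)
    also have "\<dots> = - y" unfolding \<tau>(2) using 3 by (simp add: field_simps)
    finally have cos: "- y = cos (2 * arctan \<tau>)" by simp
    have bnd: "0 \<le> 2 * arctan \<tau>" "2 * arctan \<tau> \<le> pi"
      using \<tau>(1) arctan_ubound[of \<tau>] by (auto simp: zero_le_arctan_iff)
    have "- cos \<theta> \<le> y \<longleftrightarrow> \<theta> \<le> 2 * arctan \<tau>" if "\<theta> \<in> {0..pi}" for \<theta>
    proof -
      have "- cos \<theta> \<le> y \<longleftrightarrow> cos (2 * arctan \<tau>) \<le> cos \<theta>" using cos by linarith
      also have "\<dots> \<longleftrightarrow> \<theta> \<le> 2 * arctan \<tau>" using that bnd by (intro cos_mono_le_eq) auto
      finally show ?thesis .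
    qed
    hence "{\<theta> \<in> {0..pi}. - cos \<theta> \<le> y} = {0..2 * arctan \<tau>}" using bnd by auto
    thus ?thesis using 3 bnd by (simp add: angle_of_def \<tau>_def)
  qed
qed

text \<open>The left side of the critical equation is strictly decreasing in \<lambda>, so its root
  is unique, \<open>THE\<close> is well defined, and comparing arguments amounts to comparing
  values.\<close>

lemma lambda_crit_iff:
  assumes "c \<ge> 0" "lam > 0"
  shows "lam \<le> lambda_crit c \<longleftrightarrow> exp (- lam) * (1 + exp (- c * lam)) \<ge> 1"
proof -
  define F where "F l = exp (- l) * (1 + exp (- c * l))" for l :: real
  have mono: "F l' < F l" if "l < l'" for l l'
  proof -
    have "c * l \<le> c * l'" using that assms by (intro mult_left_mono) auto
    thus ?thesis unfolding F_def using that by (intro mult_less_le_imp_less) (auto simp: add_pos_pos)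
  qed
  \<comment> \<open>At 0 the function equals 2; at \<open>ln 2\<close> the first factor is 1/2 and
    the second at most 2.\<close>
  have "\<exists>l. 0 \<le> l \<and> l \<le> ln 2 \<and> F l = 1"
  proof (rule IVT2')
    have "F (ln 2) = (1 + exp (- c * ln 2)) / 2" by (simp add: F_def exp_minus)
    also have "\<dots> \<le> (1 + 1) / 2" using assms by (intro divide_right_mono add_left_mono) auto
    finally show "F (ln 2) \<le> 1" by simp
    show "1 \<le> F 0" by (simp add: F_def)
    show "continuous_on {0..ln 2} F" unfolding F_def by (intro continuous_intros)
  qed auto
  then obtain l where l: "0 \<le> l" "F l = 1" by auto
  have "l \<noteq> 0" using l by (auto simp: F_def)
  hence lpos: "l > 0" using l by simp
  have "lambda_crit c = l"
    unfolding lambda_crit_def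
  proof (rule the_equality)
    fix l' assume "0 < l' \<and> exp (- l') * (1 + exp (- c * l')) = 1"
    hence "F l' = F l" using l by (simp add: F_def)
    thus "l' = l" using mono[of l l'] mono[of l' l] by (cases l l' rule: linorder_cases) auto
  qed (use lpos l in \<open>auto simp: F_def\<close>)
  moreover have "lam \<le> l \<longleftrightarrow> F lam \<ge> F l"
    using mono[of lam l] mono[of l lam] by (cases lam l rule: linorder_cases) auto
  ultimately show ?thesis using l by (simp add: F_def)
qed

section \<open>The density as an angle\<close>

locale qMP_params =
  fixes c lam :: real
  assumes c_nonneg: "c \<ge> 0" and lam_pos: "lam > 0"
begin

definition "s = exp (- lam)"
definition "w = exp (- c * lam)"

sublocale lim_params w
  using c_nonneg lam_pos by unfold_locales (auto simp: w_def)

lemma s_pos: "s > 0" and s_less_1: "s < 1"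
  using lam_pos by (auto simp: s_def)

lemma s_powr: "s powr (c + 1) = w * s"
  by (simp add: s_def w_def powr_def algebra_simps flip: exp_add)

lemma s01: "s \<in> {0..1}" using s_pos s_less_1 by auto

text \<open>The edge \<open>a\<close>, like \<open>b\<close> below, is an end of the range of the
  symbol at \<open>u = s\<close>, that is, at \<open>t = 1\<close>.\<close>

lemma mp_a_eq: "mp_a c lam = lim_D w s - 2 * lim_B w s"
  unfolding lim_D_minus_lim_B[OF s01] mp_a_def Let_def s_def[symmetric] s_powr
  by (simp add: lim_A_def lim_C_def mult_ac)

lemma mp_b_eq: "mp_b c lam = lim_D w s + 2 * lim_B w s"
proof -
  have "mp_b c lam = (sqrt (lim_A w s) + sqrt (lim_C w s))\<^sup>2"
    unfolding mp_b_def Let_def s_def[symmetric] s_powr by (simp add: lim_A_def lim_C_def mult_ac)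
  also have "\<dots> = lim_D w s + 2 * lim_B w s"
    using lim_A_bounds[OF s01] lim_C_bounds[OF s01]
    by (simp add: lim_D_def lim_B_def power2_sum real_sqrt_mult)
  finally show ?thesis .
qed

text \<open>The value of \<open>- cos \<theta>\<close> at which the substitution for
  \<open>x / u\<close> reaches \<open>u = s\<close>.\<close>

definition "cos_arg x = (x / s - (1 + w)) / (2 * sqrt (w * (1 - x)))"

text \<open>In both regimes the argument of the arctangent is
  \<open>sqrt ((1 + y) / (1 - y))\<close> with \<open>y = cos_arg x\<close>. The point
  \<open>b\<close> is excluded because above the critical value the density is set to 0 there while
  the angle is \<open>pi\<close>.\<close>

lemma rho_eq_angle:
  assumes x: "0 < x" "x < 1" "x \<noteq> mp_b c lam"
  shows "pi * rho_qMP c lam x = angle_of (cos_arg x) / (lam * x)"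
proof -
  define T where "T = sqrt ((1 - s) * (1 - w * s))"
  define r where "r = sqrt (1 - x)"
  \<comment> \<open>Signed square roots of \<open>1 - a\<close> and \<open>1 - b\<close>; only
    \<open>rb\<close> can be negative.\<close>
  define ra rb where "ra = s * sqrt w + T" and "rb = s * sqrt w - T"
  define y where "y = cos_arg x"
  have ws: "w * s < 1" using mult_le_less_imp_less[of w 1 s 1] w_le_1 w_pos s_pos s_less_1 by simp
  hence T: "T > 0" "T\<^sup>2 = (1 - s) * (1 - w * s)" using s_less_1 by (auto simp: T_def)
  have ra: "ra > 0" unfolding ra_def using T s_pos w_pos by (simp add: add_pos_pos)
  have r: "r > 0" "r\<^sup>2 = 1 - x" using x by (auto simp: r_def)
  have sqw: "sqrt w * sqrt w = w" using w_pos by simp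
  have rab: "ra * rb = s * (1 + w) - 1"
  proof -
    have "ra * rb = s * s * (sqrt w * sqrt w) - T\<^sup>2"
      by (simp add: ra_def rb_def power2_eq_square algebra_simps)
    thus ?thesis unfolding sqw T(2) by (simp add: algebra_simps)
  qed
  \<comment> \<open>Since \<open>ra * rb = s * (1 + w) - 1\<close>, the critical equation says
    \<open>rb = 0\<close>.\<close>
  have crit: "lam \<le> lambda_crit c \<longleftrightarrow> rb \<ge> 0"
  proof -
    have "lam \<le> lambda_crit c \<longleftrightarrow> ra * rb \<ge> 0"
      unfolding lambda_crit_iff[OF c_nonneg lam_pos] rab s_def w_def by simp
    thus ?thesis using ra by (simp add: zero_le_mult_iff)
  qed
  have one_a: "1 - mp_a c lam = ra\<^sup>2" and one_b: "1 - mp_b c lam = rb\<^sup>2"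
    unfolding mp_a_eq mp_b_eq using one_minus_lim_D_minus_lim_B[OF s01] one_minus_lim_D_plus_lim_B[OF s01]
    by (simp_all add: ra_def rb_def T_def)
  have sa: "sqrt (1 - mp_a c lam) = ra" and sb: "sqrt (1 - mp_b c lam) = \<bar>rb\<bar>"
    unfolding one_a one_b using ra by auto
  have xa: "x - mp_a c lam = (ra - r) * (ra + r)" and bx: "mp_b c lam - x = (r - rb) * (r + rb)"
    using one_a one_b r(2) by (auto simp: power2_eq_square algebra_simps)
  define E where "E = 2 * (sqrt w * r)"
  have E: "E > 0" using w_pos r by (simp add: E_def)
  have yE: "y * (s * E) = x - s * (1 + w)"
  proof -
    have "y = (x / s - (1 + w)) / E"
      by (simp add: y_def cos_arg_def E_def r_def real_sqrt_mult)
    hence "y * E = x / s - (1 + w)" using E by simp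
    hence "s * (y * E) = s * (x / s - (1 + w))" by simp
    also have "\<dots> = x - s * (1 + w)" using s_pos by (simp add: field_simps)
    finally show ?thesis by (simp add: mult_ac)
  qed
  have sE: "s * E > 0" using E s_pos by simp
  have sum: "ra + rb = 2 * s * sqrt w" by (simp add: ra_def rb_def)
  \<comment> \<open>The factorisations of \<open>1 + y\<close> and \<open>1 - y\<close> locate the
    ends of the angle. For \<open>rb \<ge> 0\<close> the point \<open>x = b\<close> is
    \<open>r = rb\<close>, where the angle returns to 0; for \<open>rb < 0\<close> it is
    \<open>r = - rb\<close>, where the angle reaches \<open>pi\<close> and stays there.\<close>
  have "(1 + y) * (s * E) = s * E + (x - s * (1 + w))" using yE by (simp add: algebra_simps)
  also have "\<dots> = (ra + rb) * r - ra * rb - r\<^sup>2" unfolding sum rab r(2) E_def by (simp add: algebra_simps)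
  also have "\<dots> = (ra - r) * (r - rb)" by (simp add: power2_eq_square algebra_simps)
  finally have y1: "(1 + y) * (s * E) = (ra - r) * (r - rb)" .
  have "(1 - y) * (s * E) = s * E - (x - s * (1 + w))" using yE by (simp add: algebra_simps)
  also have "\<dots> = (ra + rb) * r + ra * rb + r\<^sup>2" unfolding sum rab r(2) E_def by (simp add: algebra_simps)
  also have "\<dots> = (r + ra) * (r + rb)" by (simp add: power2_eq_square algebra_simps)
  finally have y2: "(1 - y) * (s * E) = (r + ra) * (r + rb)" .
  have s1: "-1 < y \<longleftrightarrow> (ra - r) * (r - rb) > 0" and s2: "y < 1 \<longleftrightarrow> r + rb > 0"
  proof -
    have pos: "0 < z * (s * E) \<longleftrightarrow> 0 < z" for z
      using sE by (meson mult_pos_pos zero_less_mult_pos2)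
    have "-1 < y \<longleftrightarrow> (1 + y) * (s * E) > 0" unfolding pos by auto
    thus "-1 < y \<longleftrightarrow> (ra - r) * (r - rb) > 0" unfolding y1 .
    have "y < 1 \<longleftrightarrow> (1 - y) * (s * E) > 0" unfolding pos by auto
    thus "y < 1 \<longleftrightarrow> r + rb > 0" unfolding y2 using ra r by (simp add: zero_less_mult_iff)
  qed
  have quot: "(1 + y) / (1 - y) = ((ra - r) * (r - rb)) / ((r + ra) * (r + rb))"
  proof -
    have "(1 + y) / (1 - y) = ((1 + y) * (s * E)) / ((1 - y) * (s * E))"
      using sE by (metis less_irrefl mult_divide_mult_cancel_right)
    thus ?thesis unfolding y1 y2 .
  qed
  have xa': "mp_a c lam < x \<longleftrightarrow> r < ra"
  proof -
    have "mp_a c lam < x \<longleftrightarrow> (ra - r) * (ra + r) > 0" using xa by linarith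
    thus ?thesis using ra r by (simp add: zero_less_mult_iff)
  qed
  show ?thesis
  proof (cases "rb \<ge> 0")
    case True
    have bx': "x < mp_b c lam \<longleftrightarrow> rb < r"
    proof -
      have "x < mp_b c lam \<longleftrightarrow> (r - rb) * (r + rb) > 0" using bx by linarith
      thus ?thesis using True r by (simp add: zero_less_mult_iff)
    qed
    have ab: "rb \<le> ra" using T by (simp add: ra_def rb_def)
    have y1': "y < 1" using s2 True r by simp
    have iff: "-1 < y \<longleftrightarrow> mp_a c lam < x \<and> x < mp_b c lam"
      unfolding s1 xa' bx' using ab by (auto simp: zero_less_mult_iff)
    show ?thesis
    proof (cases "-1 < y")
      case True1: True
      hence rr: "r < ra" "rb < r" using iff xa' bx' by auto
      have "sqrt ((x - mp_a c lam) * (mp_b c lam - x)) / ((r + ra) * (r + rb)) = sqrt ((1 + y) / (1 - y))"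
      proof (rule real_sqrt_unique[symmetric])
        have "(sqrt ((x - mp_a c lam) * (mp_b c lam - x)) / ((r + ra) * (r + rb)))\<^sup>2
            = ((ra - r) * (ra + r)) * ((r - rb) * (r + rb)) / ((r + ra) * (r + rb))\<^sup>2"
          unfolding xa bx power_divide using rr r ra True by (subst real_sqrt_pow2) auto
        also have "\<dots> = (1 + y) / (1 - y)"
        proof -
          have "(X * A) * (Y * B) / (A * B)\<^sup>2 = X * Y / (A * B)" if "A > 0" "B > 0" for X Y A B :: real
            using that by (simp add: power2_eq_square)
          thus ?thesis unfolding quot using r ra True by (simp add: add.commute[of ra])
        qed
        finally show "(sqrt ((x - mp_a c lam) * (mp_b c lam - x)) / ((r + ra) * (r + rb)))\<^sup>2 = (1 + y) / (1 - y)" .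
        show "0 \<le> sqrt ((x - mp_a c lam) * (mp_b c lam - x)) / ((r + ra) * (r + rb))"
          unfolding xa bx using rr r ra True by simp
      qed
      moreover have "rho_qMP c lam x = 2 / (pi * lam * x) * arctan (sqrt ((x - mp_a c lam) * (mp_b c lam - x)) / ((r + ra) * (r + rb)))"
        using True True1 iff crit sa sb by (simp add: rho_qMP_def r_def)
      ultimately show ?thesis
        using True1 y1' by (simp add: angle_of_def y_def[symmetric])
    next
      case False
      hence "rho_qMP c lam x = 0" using True crit iff by (auto simp: rho_qMP_def)
      thus ?thesis using False by (simp add: angle_of_def y_def[symmetric])
    qed
  next
    case False
    hence rb: "rb < 0" by simp
    have bx': "x < mp_b c lam \<longleftrightarrow> r + rb > 0"
    proof -
      have "x < mp_b c lam \<longleftrightarrow> (r - rb) * (r + rb) > 0" using bx by linarith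
      thus ?thesis using rb r by (simp add: zero_less_mult_iff)
    qed
    have i1: "-1 < y \<longleftrightarrow> mp_a c lam < x"
      unfolding s1 xa' using rb r by (auto simp: zero_less_mult_iff)
    have i2: "y < 1 \<longleftrightarrow> x < mp_b c lam" unfolding s2 bx' ..
    have ab: "mp_a c lam < mp_b c lam"
    proof -
      have "mp_b c lam - mp_a c lam = (ra - rb) * (ra + rb)"
        using one_a one_b by (simp add: power2_eq_square algebra_simps)
      also have "\<dots> > 0" using T s_pos w_pos unfolding sum by (simp add: ra_def rb_def)
      finally show ?thesis by simp
    qed
    consider "x \<le> mp_a c lam" | "mp_a c lam < x" "x < mp_b c lam" | "x > mp_b c lam"
      using x by linarith
    thus ?thesis
    proof cases
      case 1
      hence "rho_qMP c lam x = 0" using rb crit ab by (auto simp: rho_qMP_def)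
      thus ?thesis using 1 i1 by (auto simp: angle_of_def y_def[symmetric] not_less)
    next
      case 2
      hence rr: "r < ra" "r + rb > 0" using xa' bx' by auto
      have "sqrt ((x - mp_a c lam) / (mp_b c lam - x)) * ((r + - rb) / (r + ra)) = sqrt ((1 + y) / (1 - y))"
      proof (rule real_sqrt_unique[symmetric])
        have "(sqrt ((x - mp_a c lam) / (mp_b c lam - x)) * ((r + - rb) / (r + ra)))\<^sup>2
            = ((ra - r) * (ra + r)) / ((r - rb) * (r + rb)) * ((r - rb)\<^sup>2 / (r + ra)\<^sup>2)"
          unfolding xa bx power_divide power_mult_distrib using rr r ra rb by (subst real_sqrt_pow2) auto
        also have "\<dots> = (1 + y) / (1 - y)"
        proof -
          have "(X * A) / (Y * B) * (Y\<^sup>2 / A\<^sup>2) = X * Y / (A * B)" if "A > 0" "B > 0" "Y > 0" for X Y A B :: real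
            using that by (simp add: power2_eq_square)
          thus ?thesis unfolding quot using r ra rb rr by (simp add: add.commute[of ra])
        qed
        finally show "(sqrt ((x - mp_a c lam) / (mp_b c lam - x)) * ((r + - rb) / (r + ra)))\<^sup>2 = (1 + y) / (1 - y)" .
        show "0 \<le> sqrt ((x - mp_a c lam) / (mp_b c lam - x)) * ((r + - rb) / (r + ra))"
          unfolding xa bx using rr r ra rb by simp
      qed
      moreover have "rho_qMP c lam x = 2 / (pi * lam * x) * arctan (sqrt ((x - mp_a c lam) / (mp_b c lam - x)) * ((r + - rb) / (r + ra)))"
        using 2 rb crit sa sb by (simp add: rho_qMP_def r_def)
      ultimately show ?thesis
        using 2 i1 i2 by (simp add: angle_of_def y_def[symmetric])
    next
      case 3
      hence "rho_qMP c lam x = 1 / (lam * x)" using rb crit ab x by (auto simp: rho_qMP_def)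
      thus ?thesis using 3 i1 i2 ab by (auto simp: angle_of_def y_def[symmetric])
    qed
  qed
qed

end

section \<open>Moments by exchanging the integrals over \<open>x\<close> and
  \<open>t\<close>\<close>

context qMP_params
begin

text \<open>Positive exactly inside the range of the symbol at \<open>u\<close>, where
  \<open>1 / (pi * sqrt (Q x u))\<close> is the arcsine density.\<close>

definition Q :: "real \<Rightarrow> real \<Rightarrow> real" where "Q x u = 4 * (lim_A w u * lim_C w u) - (x - lim_D w u)\<^sup>2"

text \<open>Up to the factor \<open>u\<^sup>2\<close>, \<open>Q x u\<close> is quadratic in \<open>1 / u\<close>, which makes the integral over \<open>u\<close>
  elementary.\<close>

lemma Q_alt: "Q x u = 4 * w * (1 - x) * u\<^sup>2 - (x - (1 + w) * u)\<^sup>2"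
  unfolding Q_def lim_A_def lim_C_def lim_D_def by (simp add: power2_eq_square algebra_simps)

text \<open>The arcsine density at \<open>u = exp (- (lam * t))\<close>, times
  \<open>pi * x ^ k\<close>. The constraints are part of the kernel, so both integrals run over the
  whole line.\<close>

definition arc_kernel :: "nat \<Rightarrow> real \<Rightarrow> real \<Rightarrow> real" where "arc_kernel k x t =
  (if 0 < Q x (exp (- (lam * t))) \<and> 0 \<le> t \<and> t \<le> 1 then x ^ k / sqrt (Q x (exp (- (lam * t)))) else 0)"

lemma Q_le: 
  assumes "u \<in> {0..1}" "0 < Q x u"
  shows "lim_D w u - 2 * lim_B w u < x" "x < lim_D w u + 2 * lim_B w u"
proof -
  have "lim_A w u * lim_C w u \<ge> 0" using lim_A_bounds[OF assms(1)] lim_C_bounds[OF assms(1)] by simp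
  hence "(x - lim_D w u)\<^sup>2 < (2 * lim_B w u)\<^sup>2" using assms(2) by (simp add: Q_def lim_B_def power_mult_distrib)
  hence "\<bar>x - lim_D w u\<bar> < 2 * lim_B w u"
    using lim_B_nonneg[OF assms(1)] by (metis abs_le_square_iff abs_of_nonneg linorder_not_le mult_nonneg_nonneg zero_le_numeral)
  thus "lim_D w u - 2 * lim_B w u < x" "x < lim_D w u + 2 * lim_B w u" by auto
qed

lemma exp01: "0 \<le> t \<Longrightarrow> exp (- (lam * t)) \<in> {0..1}"
  using lam_pos by auto

lemma Q_pos_imp:
  assumes "u \<in> {0..1}" "0 < Q x u"
  shows "0 < x" "x < 1"
  using Q_le[OF assms] lim_D_lim_B_bounds[OF assms(1)] by auto

lemma arc_kernel_eq_0: "x \<notin> {0<..<1} \<Longrightarrow> arc_kernel k x t = 0"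
  using Q_pos_imp[OF exp01, of t x] by (auto simp: arc_kernel_def)

lemma arc_kernel_measurable [measurable]:
  "(\<lambda>(x, t). arc_kernel k x t) \<in> borel_measurable (lborel \<Otimes>\<^sub>M lborel)"
  unfolding arc_kernel_def Q_alt by measurable

text \<open>Substituting \<open>x = lim_symbol w u \<theta>\<close> cancels the singular factor
  against the derivative. At \<open>t = 0\<close> the arc shrinks to a point, hence the open
  interval.\<close>

lemma nn_integral_kernel_x:
  assumes t: "t \<in> {0<..<1}"
  shows "(\<integral>\<^sup>+x. arc_kernel k x t \<partial>lborel) = ennreal (pi * toeplitz_power w k (exp (- (lam * t))) 0)"
proof -
  define u where "u = exp (- (lam * t))"
  have u: "0 < u" "u < 1" using t lam_pos by (auto simp: u_def)
  hence u01: "u \<in> {0..1}" by auto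
  have "w * u < 1" using mult_le_less_imp_less[of w 1 u 1] w_le_1 w_pos u by simp
  hence AC: "lim_A w u * lim_C w u > 0" using u w_pos by (simp add: lim_A_def lim_C_def)
  define B where "B = lim_B w u"
  have B: "B > 0" "B\<^sup>2 = lim_A w u * lim_C w u" using AC by (auto simp: B_def lim_B_def)
  let ?g = "lim_symbol w u" and ?g' = "\<lambda>\<theta>. 2 * B * sin \<theta>"
  have ends: "?g 0 = lim_D w u - 2 * B" "?g pi = lim_D w u + 2 * B"
    by (auto simp: lim_symbol_def B_def)
  have [measurable]: "(\<lambda>x. arc_kernel k x t) \<in> borel_measurable borel"
    unfolding arc_kernel_def Q_alt by measurable
  have "(\<integral>\<^sup>+x. arc_kernel k x t \<partial>lborel) = (\<integral>\<^sup>+x. arc_kernel k x t * indicator {?g 0..?g pi} x \<partial>lborel)"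
    using Q_le[OF u01] by (intro nn_integral_cong) (auto simp: arc_kernel_def ends B_def u_def[symmetric] indicator_def intro: less_imp_le)
  also have "\<dots> = (\<integral>\<^sup>+\<theta>. arc_kernel k (?g \<theta>) t * ?g' \<theta> * indicator {0..pi} \<theta> \<partial>lborel)"
  proof (rule nn_integral_substitution)
    show "(?g has_real_derivative ?g' \<theta>) (at \<theta>)" for \<theta>
      unfolding lim_symbol_def B_def by (auto intro!: derivative_eq_intros)
    show "0 \<le> ?g' \<theta>" if "\<theta> \<in> {0..pi}" for \<theta> using that B sin_ge_zero[of \<theta>] by auto
  qed (auto intro!: continuous_intros simp: set_borel_measurable_def)
  also have "\<dots> = (\<integral>\<^sup>+\<theta>. (if \<theta> \<in> {0..pi} then ?g \<theta> ^ k else 0) \<partial>lborel)"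
  proof (rule nn_integral_cong_AE)
    have *: "arc_kernel k (?g \<theta>) t * ?g' \<theta> * indicator {0..pi} \<theta> = (if \<theta> \<in> {0..pi} then ?g \<theta> ^ k else 0)"
      if "\<theta> \<noteq> 0" "\<theta> \<noteq> pi" for \<theta>
    proof (cases "\<theta> \<in> {0<..<pi}")
      case True
      hence sin: "?g' \<theta> > 0" using B by (simp add: sin_gt_zero)
      \<comment> \<open>The root of \<open>Q\<close> is exactly the derivative of the
        substitution.\<close>
      have "Q (?g \<theta>) u = (?g' \<theta>)\<^sup>2"
        unfolding Q_def lim_symbol_def B(2)[symmetric] B_def[symmetric]
        by (simp add: power_mult_distrib sin_squared_eq algebra_simps)
      hence "arc_kernel k (?g \<theta>) t = ?g \<theta> ^ k / ?g' \<theta>"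
        using sin t by (simp add: arc_kernel_def u_def[symmetric])
      hence "arc_kernel k (?g \<theta>) t * ?g' \<theta> = ?g \<theta> ^ k"
        using sin by (metis less_irrefl nonzero_eq_divide_eq)
      thus ?thesis using True by simp
    qed (use that in auto)
    show "AE \<theta> in lborel. ennreal (arc_kernel k (?g \<theta>) t * ?g' \<theta> * indicator {0..pi} \<theta>)
        = ennreal (if \<theta> \<in> {0..pi} then ?g \<theta> ^ k else 0)"
      using AE_lborel_singleton[of 0] AE_lborel_singleton[of pi] by eventually_elim (simp add: *)
  qed
  also have "\<dots> = ennreal (integral {0..pi} (\<lambda>\<theta>. ?g \<theta> ^ k))"
  proof (rule nn_integral_has_integral_lborel)
    have "(\<lambda>\<theta>. indicator {0..pi} \<theta> * ?g \<theta> ^ k) \<in> borel_measurable borel"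
      unfolding lim_symbol_def by measurable
    thus "(\<lambda>\<theta>. if \<theta> \<in> {0..pi} then ?g \<theta> ^ k else 0) \<in> borel_measurable borel"
      by (rule measurable_cong[THEN iffD1, rotated]) (auto simp: indicator_def)
    show "0 \<le> (if \<theta> \<in> {0..pi} then ?g \<theta> ^ k else 0)" for \<theta>
      using lim_symbol_bounds[OF u01, of \<theta>] by simp
    show "((\<lambda>\<theta>. if \<theta> \<in> {0..pi} then ?g \<theta> ^ k else 0) has_integral integral {0..pi} (\<lambda>\<theta>. ?g \<theta> ^ k)) UNIV"
      unfolding has_integral_restrict_UNIV
      by (intro integrable_integral integrable_continuous_real continuous_intros continuous_on_lim_symbol)
  qed
  also have "integral {0..pi} (\<lambda>\<theta>. ?g \<theta> ^ k) = pi * toeplitz_power w k u 0"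
    by (simp add: toeplitz_power_def)
  finally show ?thesis by (simp add: u_def)
qed

text \<open>After the substitution the integrand is the constant \<open>x ^ k / (lam * x)\<close>,
  so only the measure of the admissible angles remains; the constraint \<open>t \<le> 1\<close> cuts
  them at \<open>cos_arg x\<close>.\<close>

lemma nn_integral_kernel_t:
  assumes x: "x \<in> {0<..<1}"
  shows "(\<integral>\<^sup>+t. arc_kernel k x t \<partial>lborel) = ennreal (x ^ k * (angle_of (cos_arg x) / (lam * x)))"
proof -
  define E where "E = 2 * sqrt (w * (1 - x))"
  have E: "E > 0" "E\<^sup>2 = 4 * w * (1 - x)" using x w_pos by (auto simp: E_def power_mult_distrib)
  \<comment> \<open>The arithmetic-geometric mean inequality for \<open>w\<close> and
    \<open>1 - x\<close>; it yields \<open>?h \<theta> \<ge> x\<close>, so that the substituted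
    \<open>t\<close> is never negative.\<close>
  have E1: "E \<le> 1 + w - x"
  proof -
    have "0 \<le> (sqrt w - sqrt (1 - x))\<^sup>2" by simp
    also have "\<dots> = w + (1 - x) - E" using x w_pos by (simp add: power2_diff E_def real_sqrt_mult)
    finally show ?thesis by simp
  qed
  let ?h = "\<lambda>\<theta>. 1 + w - E * cos \<theta>"
  have h: "?h \<theta> \<ge> x" for \<theta>
  proof -
    have "E * cos \<theta> \<le> E * 1" using E by (intro mult_left_mono) auto
    thus ?thesis using E1 by linarith
  qed
  hence h_pos: "?h \<theta> > 0" for \<theta> using x by (smt (verit) greaterThanLessThan_iff)
  \<comment> \<open>The solution \<open>t\<close> of
    \<open>exp (- (lam * t)) * ?h \<theta> = x\<close>, with its derivative.\<close>
  let ?g = "\<lambda>\<theta>. ln (?h \<theta> / x) / lam" and ?g' = "\<lambda>\<theta>. E * sin \<theta> / ?h \<theta> / lam"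
  have [measurable]: "(\<lambda>t. arc_kernel k x t) \<in> borel_measurable borel"
    unfolding arc_kernel_def Q_alt by measurable
  have Qx: "Q x u = (E * u)\<^sup>2 - (x - (1 + w) * u)\<^sup>2" for u
    unfolding Q_alt power_mult_distrib E(2) ..
  have range: "t \<in> {?g 0..?g pi}" if "0 < Q x (exp (- (lam * t)))" for t
  proof -
    let ?u = "exp (- (lam * t))"
    have "(x - (1 + w) * ?u)\<^sup>2 < (E * ?u)\<^sup>2" using that unfolding Qx by simp
    hence "\<bar>x - (1 + w) * ?u\<bar> < \<bar>E * ?u\<bar>"
      by (meson abs_le_square_iff not_le)
    hence "\<bar>x - (1 + w) * ?u\<bar> < E * ?u" using E by (simp add: abs_mult)
    hence "(1 + w - E) * ?u < x" "x < (1 + w + E) * ?u" by (auto simp: algebra_simps)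
    hence "?h 0 / x < exp (lam * t)" "exp (lam * t) < ?h pi / x"
      using x by (auto simp: exp_minus field_simps)
    hence "ln (?h 0 / x) < ln (exp (lam * t))" "ln (exp (lam * t)) < ln (?h pi / x)"
      using x h_pos[of 0] h_pos[of pi] by (auto intro!: ln_less_cancel_iff[THEN iffD2] simp del: ln_exp)
    thus ?thesis using lam_pos by (auto simp: field_simps)
  qed
  have "(\<integral>\<^sup>+t. arc_kernel k x t \<partial>lborel) = (\<integral>\<^sup>+t. arc_kernel k x t * indicator {?g 0..?g pi} t \<partial>lborel)"
    using range by (intro nn_integral_cong) (auto simp: arc_kernel_def indicator_def)
  also have "\<dots> = (\<integral>\<^sup>+\<theta>. arc_kernel k x (?g \<theta>) * ?g' \<theta> * indicator {0..pi} \<theta> \<partial>lborel)"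
  proof (rule nn_integral_substitution)
    show "(?g has_real_derivative ?g' \<theta>) (at \<theta>)" for \<theta>
    proof -
      have "(?h has_real_derivative E * sin \<theta>) (at \<theta>)"
        by (auto intro!: derivative_eq_intros)
      hence "((\<lambda>\<theta>. ln (?h \<theta> / x)) has_real_derivative 1 / (?h \<theta> / x) * (E * sin \<theta> / x)) (at \<theta>)"
        using h_pos[of \<theta>] x by (intro DERIV_chain2[OF DERIV_ln_divide] DERIV_cdivide) auto
      hence "(?g has_real_derivative 1 / (?h \<theta> / x) * (E * sin \<theta> / x) / lam) (at \<theta>)"
        by (rule DERIV_cdivide)
      thus ?thesis using x by simp
    qed
    show "continuous_on {0..pi} ?g'"
      using h_pos lam_pos by (intro continuous_intros) (auto simp: less_imp_neq[symmetric])
    show "0 \<le> ?g' \<theta>" if "\<theta> \<in> {0..pi}" for \<theta>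
      using that E h_pos[of \<theta>] lam_pos by (auto intro!: sin_ge_zero divide_nonneg_pos mult_nonneg_nonneg)
  qed (auto simp: set_borel_measurable_def)
  also have "\<dots> = (\<integral>\<^sup>+\<theta>. ennreal (x ^ k / (lam * x)) * indicator {\<theta> \<in> {0..pi}. - cos \<theta> \<le> cos_arg x} \<theta> \<partial>lborel)"
  proof (rule nn_integral_cong_AE)
    have *: "ennreal (arc_kernel k x (?g \<theta>) * ?g' \<theta> * indicator {0..pi} \<theta>)
        = ennreal (x ^ k / (lam * x)) * indicator {\<theta> \<in> {0..pi}. - cos \<theta> \<le> cos_arg x} \<theta>"
      if "\<theta> \<noteq> 0" "\<theta> \<noteq> pi" for \<theta>
    proof (cases "\<theta> \<in> {0<..<pi}")
      case True
      hence sin: "sin \<theta> > 0" by (simp add: sin_gt_zero)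
      define u where "u = exp (- (lam * ?g \<theta>))"
      have u: "u = x / ?h \<theta>"
        using h_pos[of \<theta>] x lam_pos by (simp add: u_def exp_minus exp_ln_iff[THEN iffD2])
      have u_pos: "u > 0" by (simp add: u_def)
      have xu: "x = u * ?h \<theta>" unfolding u using h_pos[of \<theta>] by simp
      have "Q x u = (E * u)\<^sup>2 - (u * (E * cos \<theta>))\<^sup>2"
        unfolding Qx by (subst xu) (simp add: power2_eq_square algebra_simps)
      also have "\<dots> = (u * E * sin \<theta>)\<^sup>2"
        by (simp add: power_mult_distrib sin_squared_eq algebra_simps)
      finally have Q: "Q x u = (u * E * sin \<theta>)\<^sup>2" .
      have g0: "0 \<le> ?g \<theta>"
        using h[of \<theta>] x lam_pos by (auto intro!: divide_nonneg_pos ln_ge_zero)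
      have g1: "?g \<theta> \<le> 1 \<longleftrightarrow> - cos \<theta> \<le> cos_arg x"
      proof -
        have "?g \<theta> \<le> 1 \<longleftrightarrow> ln (?h \<theta> / x) \<le> ln (exp lam)" using lam_pos by (simp add: field_simps)
        also have "\<dots> \<longleftrightarrow> ?h \<theta> / x \<le> exp lam"
          using h_pos[of \<theta>] x by (subst ln_le_cancel_iff) auto
        also have "\<dots> \<longleftrightarrow> ?h \<theta> \<le> x / s" using x by (simp add: s_def exp_minus field_simps)
        also have "\<dots> \<longleftrightarrow> - cos \<theta> * E \<le> x / s - (1 + w)" by (auto simp: algebra_simps)
        also have "\<dots> \<longleftrightarrow> - cos \<theta> \<le> cos_arg x"
          unfolding cos_arg_def E_def[symmetric] using E by (simp add: pos_le_divide_eq)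
        finally show ?thesis .
      qed
      have "arc_kernel k x (?g \<theta>) * ?g' \<theta> = (if - cos \<theta> \<le> cos_arg x then x ^ k / (lam * x) else 0)"
      proof (cases "- cos \<theta> \<le> cos_arg x")
        case True
        have "arc_kernel k x (?g \<theta>) = x ^ k / (u * E * sin \<theta>)"
          unfolding arc_kernel_def u_def[symmetric] Q using g0 g1 True sin u_pos E by simp
        hence "arc_kernel k x (?g \<theta>) * ?g' \<theta> = x ^ k / (lam * (u * ?h \<theta>))"
          using sin E by (simp add: field_simps)
        thus ?thesis using True xu by simp
      qed (use g1 in \<open>simp add: arc_kernel_def\<close>)
      thus ?thesis using True by (auto simp: indicator_def)
    qed (use that in \<open>auto simp: indicator_def\<close>)
    show "AE \<theta> in lborel. ennreal (arc_kernel k x (?g \<theta>) * ?g' \<theta> * indicator {0..pi} \<theta>)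
        = ennreal (x ^ k / (lam * x)) * indicator {\<theta> \<in> {0..pi}. - cos \<theta> \<le> cos_arg x} \<theta>"
      using AE_lborel_singleton[of 0] AE_lborel_singleton[of pi] by eventually_elim (rule *)
  qed
  also have "\<dots> = ennreal (x ^ k / (lam * x)) * ennreal (angle_of (cos_arg x))"
    unfolding emeasure_cos_ge[symmetric] by (rule nn_integral_cmult_indicator) measurable
  also have "\<dots> = ennreal (x ^ k * (angle_of (cos_arg x) / (lam * x)))"
    using x lam_pos by (subst ennreal_mult''[symmetric]) (auto simp: angle_of_def zero_le_arctan_iff)
  finally show ?thesis .
qed

lemma rho_nonneg:
  assumes "x \<in> {0..1}"
  shows "rho_qMP c lam x \<ge> 0"
proof -
  have "mp_a c lam \<le> 1" "mp_b c lam \<le> 1"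
    unfolding mp_a_eq mp_b_eq using lim_D_lim_B_bounds[OF s01] lim_B_nonneg[OF s01] by auto
  thus ?thesis using assms lam_pos
    by (auto simp: rho_qMP_def Let_def zero_le_arctan_iff intro!: mult_nonneg_nonneg divide_nonneg_nonneg add_nonneg_nonneg)
qed

text \<open>Integrating \<open>arc_kernel\<close> over \<open>t\<close> first gives
  \<open>pi * x ^ k\<close> times the density, over \<open>x\<close> first \<open>pi\<close> times
  the Toeplitz diagonal. The case \<open>k = 0\<close> says that the density has mass 1.\<close>

lemma moment_rho:
  "((\<lambda>x. x ^ k * rho_qMP c lam x) has_integral
     integral {0..1} (\<lambda>t. toeplitz_power w k (exp (- (lam * t))) 0)) {0..1}"
proof -
  let ?G = "\<lambda>t. toeplitz_power w k (exp (- (lam * t))) 0"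
  \<comment> \<open>The angle formula is available on the open interval; the end points do not
    affect the integral.\<close>
  define R where "R x = (if x \<in> {0<..<1} then x ^ k * rho_qMP c lam x else 0)" for x
  have "continuous_on {0..1} ?G"
    using lam_pos by (intro continuous_on_compose2[OF continuous_on_toeplitz_power] continuous_intros) auto
  hence int: "(?G has_integral integral {0..1} ?G) {0..1}"
    by (intro integrable_integral integrable_continuous_real)
  have [measurable]: "rho_qMP c lam \<in> borel_measurable borel"
    unfolding rho_qMP_def Let_def by measurable
  have "(\<lambda>x. indicator {0<..<1} x * (x ^ k * rho_qMP c lam x)) \<in> borel_measurable borel" by measurable
  hence [measurable]: "R \<in> borel_measurable borel"
    by (rule measurable_cong[THEN iffD1, rotated]) (auto simp: indicator_def R_def)
  have R0: "R x \<ge> 0" for x using rho_nonneg[of x] by (auto simp: R_def)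
  have G0: "?G t \<ge> 0" if "t \<in> {0..1}" for t
    unfolding toeplitz_power_def using lim_symbol_bounds[OF exp01[of t]] that
    by (auto intro!: integral_nonneg divide_nonneg_nonneg integrable_continuous_real continuous_intros continuous_on_lim_symbol)
  have "(\<integral>\<^sup>+x. ennreal pi * R x \<partial>lborel) = (\<integral>\<^sup>+x. (\<integral>\<^sup>+t. arc_kernel k x t \<partial>lborel) \<partial>lborel)"
  proof (rule nn_integral_cong_AE)
    have *: "ennreal pi * R x = (\<integral>\<^sup>+t. arc_kernel k x t \<partial>lborel)" if "x \<noteq> mp_b c lam" for x
    proof (cases "x \<in> {0<..<1}")
      case True
      have "ennreal pi * R x = ennreal (x ^ k * (pi * rho_qMP c lam x))"
        using True by (simp add: R_def mult_ac flip: ennreal_mult')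
      thus ?thesis using True that by (simp add: nn_integral_kernel_t rho_eq_angle)
    qed (auto simp: R_def arc_kernel_eq_0)
    show "AE x in lborel. ennreal pi * R x = (\<integral>\<^sup>+t. arc_kernel k x t \<partial>lborel)"
      using AE_lborel_singleton[of "mp_b c lam"] by eventually_elim (rule *)
  qed
  also have "\<dots> = (\<integral>\<^sup>+t. (\<integral>\<^sup>+x. arc_kernel k x t \<partial>lborel) \<partial>lborel)"
    by (rule lborel_pair.Fubini') (use arc_kernel_measurable in measurable)
  also have "\<dots> = (\<integral>\<^sup>+t. ennreal pi * ennreal (if t \<in> {0..1} then ?G t else 0) \<partial>lborel)"
  proof (rule nn_integral_cong_AE)
    have *: "(\<integral>\<^sup>+x. arc_kernel k x t \<partial>lborel) = ennreal pi * ennreal (if t \<in> {0..1} then ?G t else 0)"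
      if "t \<noteq> 0" "t \<noteq> 1" for t
    proof (cases "t \<in> {0<..<1}")
      case True
      thus ?thesis by (simp add: nn_integral_kernel_x flip: ennreal_mult')
    qed (use that in \<open>auto simp: arc_kernel_def\<close>)
    show "AE t in lborel. (\<integral>\<^sup>+x. arc_kernel k x t \<partial>lborel) = ennreal pi * ennreal (if t \<in> {0..1} then ?G t else 0)"
      using AE_lborel_singleton[of 0] AE_lborel_singleton[of 1] by eventually_elim (rule *)
  qed
  also have "\<dots> = ennreal pi * (\<integral>\<^sup>+t. ennreal (if t \<in> {0..1} then ?G t else 0) \<partial>lborel)"
  proof (rule nn_integral_cmult)
    have "(\<lambda>t. if t \<in> {0..1} then ?G t else 0) \<in> borel_measurable borel"
      using \<open>continuous_on {0..1} ?G\<close> by (intro borel_measurable_continuous_on_if) auto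
    thus "(\<lambda>t. ennreal (if t \<in> {0..1} then ?G t else 0)) \<in> borel_measurable lborel" by simp
  qed
  also have "(\<integral>\<^sup>+t. ennreal (if t \<in> {0..1} then ?G t else 0) \<partial>lborel) = ennreal (integral {0..1} ?G)"
  proof (rule nn_integral_has_integral_lborel)
    show "(\<lambda>t. if t \<in> {0..1} then ?G t else 0) \<in> borel_measurable borel"
      using \<open>continuous_on {0..1} ?G\<close> by (intro borel_measurable_continuous_on_if) auto
    show "((\<lambda>t. if t \<in> {0..1} then ?G t else 0) has_integral integral {0..1} ?G) UNIV"
      unfolding has_integral_restrict_UNIV by (rule int)
  qed (use G0 in auto)
  also have "(\<integral>\<^sup>+x. ennreal pi * R x \<partial>lborel) = ennreal pi * (\<integral>\<^sup>+x. R x \<partial>lborel)"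
    by (rule nn_integral_cmult) measurable
  finally have "(\<integral>\<^sup>+x. R x \<partial>lborel) = ennreal (integral {0..1} ?G)"
    by (subst (asm) ennreal_mult_cancel_left) (auto simp: ennreal_eq_0_iff pi_gt_zero[THEN not_le[THEN iffD2]])
  hence "(R has_integral integral {0..1} ?G) UNIV"
    using R0 int G0 by (intro nn_integral_has_integral) (auto intro: has_integral_nonneg)
  moreover have "R = (\<lambda>x. if x \<in> {0<..<1} then x ^ k * rho_qMP c lam x else 0)"
    by (rule ext) (simp only: R_def)
  ultimately show ?thesis
    by (simp only: has_integral_restrict_UNIV has_integral_Icc_iff_Ioo)
qed

end

section \<open>Convergence of the zero counting measures\<close>

context little_q_laguerre_params
begin

text \<open>Rescaling the polynomials turns their recurrence into a symmetric one, to which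
  \<open>power_sum_eq\<close> applies.\<close>

lemma power_sum_roots:
  assumes "n > 0"
  shows "\<bar>(\<Sum>x | poly (p n) x = 0. x ^ k)
     - (\<Sum>i<n - k. jacobi_power (\<lambda>i. A i + C i) (\<lambda>i. - sqrt (A i * C (Suc i))) k i i)\<bar> \<le> k"
proof -
  \<comment> \<open>The ratio of consecutive factors balances the coefficients \<open>A i\<close>
    and \<open>C (Suc i)\<close> into their geometric mean.\<close>
  define g where "g i = (\<Prod>j<i. sqrt (A j / C (Suc j)))" for i
  have g_pos: "g i > 0" for i
    unfolding g_def using A_pos C_Suc_pos by (intro prod_pos) auto
  have sq: "A j > 0" "C (Suc j) > 0" for j using A_pos C_Suc_pos by auto
  have up: "- sqrt (A i * C (Suc i)) * g (Suc i) = - (A i * g i)" for i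
  proof -
    have "sqrt (A i * C (Suc i)) * sqrt (A i / C (Suc i)) = sqrt ((A i)\<^sup>2)"
      using sq[of i] by (simp add: power2_eq_square flip: real_sqrt_mult)
    thus ?thesis using sq(1)[of i] by (simp add: g_def)
  qed
  have down: "- sqrt (A i * C (Suc i)) * g i = - (C (Suc i) * g (Suc i))" for i
  proof -
    have "C (Suc i) * sqrt (A i / C (Suc i)) = sqrt ((C (Suc i))\<^sup>2 * (A i / C (Suc i)))"
      using sq[of i] by (subst real_sqrt_mult) simp
    also have "(C (Suc i))\<^sup>2 * (A i / C (Suc i)) = A i * C (Suc i)"
      using sq[of i] by (simp add: power2_eq_square)
    finally show ?thesis by (simp add: g_def)
  qed
  interpret jacobi_recurrence "\<lambda>i. A i + C i" "\<lambda>i. - sqrt (A i * C (Suc i))" "\<lambda>i x. g i * poly (p i) x"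
  proof
    fix x :: real and i :: nat
    show "g 0 * poly (p 0) x = 1" by (simp add: g_def)
    have "- sqrt (A 0 * C (Suc 0)) * (g 1 * poly (p 1) x) = - (A 0 * poly (p 1) x) * g 0"
      using up[of 0] by (simp add: mult_ac flip: mult.assoc)
    thus "x * (g 0 * poly (p 0) x) = (A 0 + C 0) * (g 0 * poly (p 0) x)
        + - sqrt (A 0 * C (Suc 0)) * (g 1 * poly (p 1) x)"
      unfolding poly_p_1 by (simp add: algebra_simps)
    have "- sqrt (A (Suc i) * C (Suc (Suc i))) * (g (Suc (Suc i)) * poly (p (Suc (Suc i))) x)
        = - (A (Suc i) * poly (p (Suc (Suc i))) x) * g (Suc i)"
      unfolding mult.assoc[symmetric] up by (simp add: mult_ac)
    moreover have "- sqrt (A i * C (Suc i)) * (g i * poly (p i) x) = - (C (Suc i) * g (Suc i)) * poly (p i) x"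
      unfolding mult.assoc[symmetric] down by simp
    ultimately show "x * (g (Suc i) * poly (p (Suc i)) x) = (A (Suc i) + C (Suc i)) * (g (Suc i) * poly (p (Suc i)) x)
        + - sqrt (A (Suc i) * C (Suc (Suc i))) * (g (Suc (Suc i)) * poly (p (Suc (Suc i))) x)
        + - sqrt (A i * C (Suc i)) * (g i * poly (p i) x)"
      unfolding poly_p_Suc_Suc by (simp only:) (simp add: algebra_simps)
  qed
  show ?thesis
    by (rule power_sum_eq) (use assms roots_p_subset[of n] card_roots_p[of n] in auto)
qed

end

text \<open>Off-diagonal entries come arbitrarily close to 0, where only this Hoelder bound is
  uniform in the row.\<close>

lemma abs_sqrt_diff_le:
  assumes "x \<ge> 0" "y \<ge> 0"
  shows "\<bar>sqrt x - sqrt y\<bar> \<le> sqrt \<bar>x - y\<bar>"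
proof -
  have *: "sqrt a \<le> sqrt b + sqrt \<bar>a - b\<bar>" if "a \<ge> 0" "b \<ge> 0" for a b :: real
  proof -
    have "sqrt a \<le> sqrt (b + \<bar>a - b\<bar>)" by simp
    also have "\<dots> \<le> sqrt b + sqrt \<bar>a - b\<bar>" using that by (intro sqrt_add_le_add_sqrt) auto
    finally show ?thesis .
  qed
  show ?thesis using *[OF assms] *[OF assms(2,1)] by (simp add: abs_minus_commute abs_le_iff)
qed

text \<open>\<open>A\<close> is off by \<open>2 * \<eta>\<close> (from \<open>a\<close> and from the
  extra \<open>q\<close>), \<open>C\<close> by \<eta>, and a shift of the index costs \<eta>. Under
  the root this adds up to \<open>4 * \<eta>\<close> at either power of \<open>q\<close>.\<close>

lemma (in lim_params) coeffs_close:
  assumes q: "0 < q" "q < 1" and a: "0 < a" "a \<le> 1" and aw: "\<bar>a - w\<bar> \<le> \<eta>" and q\<eta>: "1 - q \<le> \<eta>"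
  shows "\<bar>qL_A a q i + qL_C a q i - lim_D w (q ^ i)\<bar> \<le> 3 * \<eta>"
    and "\<bar>- sqrt (qL_A a q i * qL_C a q (Suc i)) + lim_B w (q ^ i)\<bar> \<le> sqrt (4 * \<eta>)"
    and "\<bar>- sqrt (qL_A a q i * qL_C a q (Suc i)) + lim_B w (q ^ Suc i)\<bar> \<le> sqrt (4 * \<eta>)"
proof -
  have pow01: "q ^ j \<in> {0..1}" for j using q by (auto intro!: power_le_one)
  have bnd: "\<bar>x * y\<bar> \<le> \<bar>x\<bar>" if "\<bar>y\<bar> \<le> 1" for x y :: real
    using mult_left_mono[OF that, of "\<bar>x\<bar>"] by (simp add: abs_mult)
  have prod01: "x * y \<in> {0..1}" if "x \<in> {0..1}" "y \<in> {0..1}" for x y :: real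
    using that by (auto simp: mult_le_one)
  have A01: "qL_A a q j \<in> {0..1}" for j
  proof -
    have "a * q ^ Suc j \<in> {0..1}" by (rule prod01[OF _ pow01]) (use a in auto)
    thus ?thesis unfolding qL_A_def by (intro prod01[OF pow01]) auto
  qed
  have C01: "qL_C a q j \<in> {0..1}" for j
    unfolding qL_C_def by (intro prod01 pow01) (use a pow01[of j] in auto)
  have A: "\<bar>qL_A a q j - lim_A w (q ^ j)\<bar> \<le> 2 * \<eta>" for j
  proof -
    have "qL_A a q j - lim_A w (q ^ j) = (w - a * q) * (q ^ j * q ^ j)"
      by (simp add: qL_A_def lim_A_def algebra_simps)
    also have "\<bar>\<dots>\<bar> \<le> \<bar>w - a * q\<bar>" by (rule bnd) (use prod01[OF pow01 pow01, of j j] in auto)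
    also have "w - a * q = (w - a) + a * (1 - q)" by (simp add: algebra_simps)
    also have "\<bar>\<dots>\<bar> \<le> \<bar>w - a\<bar> + \<bar>(1 - q) * a\<bar>" by (simp add: mult.commute)
    also have "\<bar>(1 - q) * a\<bar> \<le> \<bar>1 - q\<bar>" by (rule bnd) (use a in auto)
    finally show ?thesis using aw q\<eta> q by linarith
  qed
  have C: "\<bar>qL_C a q j - lim_C w (q ^ j)\<bar> \<le> \<eta>" for j
  proof -
    have "qL_C a q j - lim_C w (q ^ j) = (a - w) * (q ^ j * (1 - q ^ j))"
      by (simp add: qL_C_def lim_C_def algebra_simps)
    also have "\<bar>\<dots>\<bar> \<le> \<bar>a - w\<bar>"
      by (rule bnd) (use prod01[OF pow01, of "1 - q ^ j" j] pow01[of j] in auto)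
    finally show ?thesis using aw by linarith
  qed
  show "\<bar>qL_A a q i + qL_C a q i - lim_D w (q ^ i)\<bar> \<le> 3 * \<eta>"
    using A[of i] C[of i] by (simp add: lim_D_def abs_le_iff)
  let ?u = "q ^ i"
  have CC: "\<bar>lim_C w (q ^ Suc i) - lim_C w ?u\<bar> \<le> \<eta>"
  proof -
    have "lim_C w (q ^ Suc i) - lim_C w ?u = (1 - q) * ((w * ?u) * ((1 + q) * ?u - 1))"
      by (simp add: lim_C_def algebra_simps)
    also have "\<bar>\<dots>\<bar> \<le> \<bar>1 - q\<bar>"
    proof (rule bnd)
      have "\<bar>(w * ?u) * ((1 + q) * ?u - 1)\<bar> \<le> \<bar>w * ?u\<bar>"
      proof (rule bnd)
        have "(1 + q) * ?u \<le> 2 * 1" using q pow01[of i] by (intro mult_mono) auto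
        thus "\<bar>(1 + q) * ?u - 1\<bar> \<le> 1" using q pow01[of i] by (auto simp: abs_le_iff)
      qed
      also have "\<dots> \<le> 1" using prod01[OF _ pow01, of w i] w_pos w_le_1 by auto
      finally show "\<bar>(w * ?u) * ((1 + q) * ?u - 1)\<bar> \<le> 1" .
    qed
    finally show ?thesis using q\<eta> q by linarith
  qed
  have AA: "\<bar>lim_A w (q ^ Suc i) - lim_A w ?u\<bar> \<le> \<eta>"
  proof -
    have "lim_A w (q ^ Suc i) - lim_A w ?u = (1 - q) * (?u * ((w * ?u) * (1 + q) - 1))"
      by (simp add: lim_A_def algebra_simps)
    also have "\<bar>\<dots>\<bar> \<le> \<bar>1 - q\<bar>"
    proof (rule bnd)
      have "\<bar>?u * ((w * ?u) * (1 + q) - 1)\<bar> \<le> \<bar>?u\<bar>"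
      proof (rule bnd)
        have wu: "w * ?u \<in> {0..1}" by (rule prod01[OF _ pow01]) (use w_pos w_le_1 in auto)
        have "(w * ?u) * (1 + q) \<le> 1 * 2" using q wu mult_mono[of "w * ?u" 1 "1 + q" 2] by auto
        moreover have "0 \<le> (w * ?u) * (1 + q)" using q wu mult_nonneg_nonneg[of "w * ?u" "1 + q"] by auto
        ultimately show "\<bar>(w * ?u) * (1 + q) - 1\<bar> \<le> 1" by (auto simp: abs_le_iff)
      qed
      also have "\<dots> \<le> 1" using pow01[of i] by auto
      finally show "\<bar>?u * ((w * ?u) * (1 + q) - 1)\<bar> \<le> 1" .
    qed
    finally show ?thesis using q\<eta> q by linarith
  qed
  have main: "\<bar>- sqrt (qL_A a q i * qL_C a q (Suc i)) + lim_B w v\<bar> \<le> sqrt (4 * \<eta>)"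
    if v: "v \<in> {0..1}" and "\<bar>qL_A a q i - lim_A w v\<bar> \<le> \<alpha>" "\<bar>qL_C a q (Suc i) - lim_C w v\<bar> \<le> \<beta>"
      "\<alpha> + \<beta> \<le> 4 * \<eta>" for v \<alpha> \<beta>
  proof -
    have "\<bar>- sqrt (qL_A a q i * qL_C a q (Suc i)) + lim_B w v\<bar>
        = \<bar>sqrt (qL_A a q i * qL_C a q (Suc i)) - sqrt (lim_A w v * lim_C w v)\<bar>"
      by (simp add: lim_B_def)
    also have "\<dots> \<le> sqrt \<bar>qL_A a q i * qL_C a q (Suc i) - lim_A w v * lim_C w v\<bar>"
      using A01[of i] C01[of "Suc i"] lim_A_bounds[OF v] lim_C_bounds[OF v] by (intro abs_sqrt_diff_le) auto
    also have "\<bar>qL_A a q i * qL_C a q (Suc i) - lim_A w v * lim_C w v\<bar> \<le> 1 * \<alpha> + \<beta>"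
      using that lim_A_bounds[OF v] C01[of "Suc i"] by (intro perturb_mult) auto
    finally show ?thesis using that(4) by (smt (verit) real_sqrt_le_iff)
  qed
  show "\<bar>- sqrt (qL_A a q i * qL_C a q (Suc i)) + lim_B w (q ^ i)\<bar> \<le> sqrt (4 * \<eta>)"
    by (rule main[OF pow01 A, of "2 * \<eta>"]) (use C[of "Suc i"] CC in linarith)+
  show "\<bar>- sqrt (qL_A a q i * qL_C a q (Suc i)) + lim_B w (q ^ Suc i)\<bar> \<le> sqrt (4 * \<eta>)"
    by (rule main[OF pow01 _ C, of "3 * \<eta>"]) (use A[of i] AA in linarith)+
qed

lemma zero_counting_integral_sum:
  "zero_counting_integral n p (\<lambda>x. \<Sum>i\<in>I. a i * f i x) = (\<Sum>i\<in>I. a i * zero_counting_integral n p (f i))"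
proof -
  have "(\<Sum>x | poly p x = 0. real (order x p) * (\<Sum>i\<in>I. a i * f i x))
      = (\<Sum>i\<in>I. \<Sum>x | poly p x = 0. a i * (real (order x p) * f i x))"
    by (subst sum.swap) (simp add: sum_distrib_left mult_ac)
  thus ?thesis
    unfolding zero_counting_integral_def by (simp add: sum_distrib_left mult_ac)
qed

section \<open>Limits along the sequences \<open>n\<close> and \<open>N\<close>\<close>

context qMP_params
begin

context
  fixes d :: nat and n N :: "nat \<Rightarrow> nat"
  assumes n: "filterlim n at_top sequentially" and N: "filterlim N at_top sequentially"
    and nN: "(\<lambda>k. real (n k) / real (N k)) \<longlonglongrightarrow> 1"
begin

definition "qN k = exp (- lam / real (N k))"
definition "aN k = qN k powr (c * real (N k) + real d)"

lemma N_pos: "eventually (\<lambda>k. N k > 0) sequentially"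
  using N[unfolded filterlim_at_top, rule_format, of 1] by eventually_elim simp

lemma n_pos: "eventually (\<lambda>k. n k > 0) sequentially"
  using n[unfolded filterlim_at_top, rule_format, of 1] by eventually_elim simp

lemma qN_bounds: "N k > 0 \<Longrightarrow> 0 < qN k \<and> qN k < 1"
  using lam_pos by (simp add: qN_def)

lemma qN_power: "qN k ^ i = exp (- (lam * (real i / real (N k))))"
  by (simp add: qN_def flip: exp_of_nat_mult)

text \<open>The part \<open>c * N\<close> of the exponent yields \<open>w\<close> exactly;
  \<open>d\<close> survives only in a factor tending to 1.\<close>

lemma aN_eq:
  assumes "N k > 0"
  shows "aN k = w * qN k ^ d"
proof -
  have "aN k = exp ((c * real (N k) + real d) * (- lam / real (N k)))"
    by (simp add: aN_def qN_def powr_def)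
  also have "(c * real (N k) + real d) * (- lam / real (N k)) = - c * lam + - (lam * (real d / real (N k)))"
    using assms by (simp add: field_simps)
  finally show ?thesis by (simp only: exp_add w_def qN_power)
qed

lemma qN_tendsto: "qN \<longlonglongrightarrow> 1"
proof -
  have "filterlim (\<lambda>k. real (N k)) at_top sequentially"
    by (rule filterlim_compose[OF filterlim_real_sequentially N])
  hence "(\<lambda>k. - lam / real (N k)) \<longlonglongrightarrow> 0"
    by (intro tendsto_divide_0[OF tendsto_const] filterlim_at_top_imp_at_infinity)
  hence "(\<lambda>k. exp (- lam / real (N k))) \<longlonglongrightarrow> exp 0" by (intro tendsto_exp)
  thus ?thesis by (simp add: qN_def[abs_def])
qed

lemma aN_tendsto: "aN \<longlonglongrightarrow> w"
proof -
  have "(\<lambda>k. w * qN k ^ d) \<longlonglongrightarrow> w * 1 ^ d" by (intro tendsto_intros qN_tendsto)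
  hence "(\<lambda>k. w * qN k ^ d) \<longlonglongrightarrow> w" by simp
  thus ?thesis
    by (rule Lim_transform_eventually) (use N_pos in \<open>eventually_elim, simp add: aN_eq\<close>)
qed

lemma aN_bounds: "N k > 0 \<Longrightarrow> 0 < aN k \<and> aN k \<le> 1"
  using qN_bounds[of k] w_pos w_le_1 by (auto simp: aN_eq intro!: mult_le_one power_le_one)

lemma params: "N k > 0 \<Longrightarrow> little_q_laguerre_params (aN k) (qN k)"
  using qN_bounds[of k] aN_bounds[of k] mult_le_less_imp_less[of "aN k" 1 "qN k" 1]
  by unfold_locales auto

lemma jacobi_power_close:
  assumes "e > 0"
  shows "eventually (\<lambda>j. \<forall>i. \<bar>jacobi_power (\<lambda>i. qL_A (aN j) (qN j) i + qL_C (aN j) (qN j) i)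
      (\<lambda>i. - sqrt (qL_A (aN j) (qN j) i * qL_C (aN j) (qN j) (Suc i))) k i i
      - toeplitz_power w k (qN j ^ i) 0\<bar> \<le> e) sequentially"
proof -
  obtain \<delta> where \<delta>: "\<delta> > 0" and approx: "\<And>d b q. 0 < q \<Longrightarrow> q < 1 \<Longrightarrow> 1 - q < \<delta> \<Longrightarrow>
           (\<forall>i. \<bar>d i - lim_D w (q ^ i)\<bar> \<le> \<delta>) \<Longrightarrow> (\<forall>i. \<bar>b i + lim_B w (q ^ i)\<bar> \<le> \<delta>) \<Longrightarrow>
           (\<forall>i. \<bar>b i + lim_B w (q ^ Suc i)\<bar> \<le> \<delta>) \<Longrightarrow>
           (\<forall>i l. \<bar>jacobi_power d b k i l - toeplitz_power w k (q ^ i) (int l - int i)\<bar> \<le> e)"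
    using jacobi_power_approx[OF assms, of k] by meson
  \<comment> \<open>Chosen so that both \<open>3 * \<eta>\<close> and
    \<open>sqrt (4 * \<eta>)\<close> are at most \<delta>.\<close>
  define \<eta> where "\<eta> = min (\<delta> / 3) (\<delta>\<^sup>2 / 4)"
  have \<eta>: "\<eta> > 0" "3 * \<eta> \<le> \<delta>" "4 * \<eta> \<le> \<delta>\<^sup>2" using \<delta> by (auto simp: \<eta>_def min_def field_simps)
  have "sqrt (4 * \<eta>) \<le> sqrt (\<delta>\<^sup>2)" using \<eta>(3) by (rule real_sqrt_le_mono)
  hence s\<eta>: "sqrt (4 * \<eta>) \<le> \<delta>" using \<delta> by simp
  have "eventually (\<lambda>j. dist (qN j) 1 < \<eta>) sequentially" "eventually (\<lambda>j. dist (aN j) w < \<eta>) sequentially"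
    using tendstoD[OF qN_tendsto \<eta>(1)] tendstoD[OF aN_tendsto \<eta>(1)] by auto
  thus ?thesis using N_pos
  proof eventually_elim
    case (elim j)
    note qb = qN_bounds[OF elim(3)] and ab = aN_bounds[OF elim(3)]
    have close: "1 - qN j \<le> \<eta>" "\<bar>aN j - w\<bar> \<le> \<eta>" using elim by (auto simp: dist_real_def)
    note cc = coeffs_close[OF conjunct1[OF qb] conjunct2[OF qb] conjunct1[OF ab] conjunct2[OF ab] close(2,1)]
    show ?case
    proof
      fix i
      have "\<forall>i l. \<bar>jacobi_power (\<lambda>i. qL_A (aN j) (qN j) i + qL_C (aN j) (qN j) i)
        (\<lambda>i. - sqrt (qL_A (aN j) (qN j) i * qL_C (aN j) (qN j) (Suc i))) k i l
        - toeplitz_power w k (qN j ^ i) (int l - int i)\<bar> \<le> e"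
      proof (rule approx)
        show "0 < qN j" "qN j < 1" using qb by auto
        show "1 - qN j < \<delta>" using close \<eta> by linarith
      qed (use cc \<eta>(2) s\<eta> in \<open>blast intro: order.trans\<close>)+
      from this[rule_format, of i i] show "\<bar>jacobi_power (\<lambda>i. qL_A (aN j) (qN j) i + qL_C (aN j) (qN j) i)
        (\<lambda>i. - sqrt (qL_A (aN j) (qN j) i * qL_C (aN j) (qN j) (Suc i))) k i i
        - toeplitz_power w k (qN j ^ i) 0\<bar> \<le> e" by simp
    qed
  qed
qed

text \<open>As \<open>qN j ^ i = exp (- (lam * (i / N j)))\<close>, the averaged Toeplitz diagonal
  is a Riemann sum in \<open>t\<close>.\<close>

lemma moments_tendsto:
  "(\<lambda>j. zero_counting_integral (n j) (little_q_laguerre (aN j) (qN j) (n j)) (\<lambda>x. x ^ k))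
     \<longlonglongrightarrow> integral {0..1} (\<lambda>x. x ^ k * rho_qMP c lam x)"
proof -
  let ?z = "\<lambda>j. zero_counting_integral (n j) (little_q_laguerre (aN j) (qN j) (n j)) (\<lambda>x. x ^ k)"
  let ?T = "\<lambda>u. toeplitz_power w k u 0"
  let ?r = "\<lambda>j. (1 / real (n j)) * (\<Sum>i<n j. ?T (qN j ^ i))"
  have "continuous_on {0..} (\<lambda>t. ?T (exp (- (lam * t))))"
    using lam_pos by (intro continuous_on_compose2[OF continuous_on_toeplitz_power] continuous_intros) auto
  from riemann_sum_tendsto[OF this n N nN]
  have r: "?r \<longlonglongrightarrow> integral {0..1} (\<lambda>x. x ^ k * rho_qMP c lam x)"
    by (simp add: qN_power integral_unique[OF moment_rho])
  have "(\<lambda>j. ?z j - ?r j) \<longlonglongrightarrow> 0"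
  proof (rule tendstoI)
    fix e :: real assume e: "e > 0"
    have "filterlim (\<lambda>k. real (n k)) at_top sequentially"
      by (rule filterlim_compose[OF filterlim_real_sequentially n])
    \<comment> \<open>One \<open>k\<close> for truncating the Jacobi matrix, one for the last
      \<open>k\<close> Toeplitz entries.\<close>
    hence "(\<lambda>j. 2 * real k / real (n j)) \<longlonglongrightarrow> 0"
      by (intro tendsto_divide_0[OF tendsto_const] filterlim_at_top_imp_at_infinity)
    hence "eventually (\<lambda>j. 2 * real k / real (n j) < e / 2) sequentially"
      using order_tendstoD(2) e by (metis half_gt_zero)
    thus "eventually (\<lambda>j. dist (?z j - ?r j) 0 < e) sequentially"
      using jacobi_power_close[OF half_gt_zero[OF e], of k] N_pos n_pos
    proof eventually_elim
      case (elim j)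
      interpret little_q_laguerre_params "aN j" "qN j" by (rule params[OF elim(3)])
      let ?J = "\<lambda>i. jacobi_power (\<lambda>i. A i + C i) (\<lambda>i. - sqrt (A i * C (Suc i))) k i i"
      have pow01: "qN j ^ i \<in> {0..1}" for i using qN_bounds[OF elim(3)] by (auto intro!: power_le_one)
      define S where "S = (\<Sum>x | poly (p (n j)) x = 0. x ^ k)"
      have 1: "\<bar>S - (\<Sum>i<n j - k. ?J i)\<bar> \<le> k"
        unfolding S_def by (rule power_sum_roots[OF elim(4)])
      have "\<bar>(\<Sum>i<n j - k. ?J i) - (\<Sum>i<n j - k. ?T (qN j ^ i))\<bar> \<le> (\<Sum>i<n j - k. \<bar>?J i - ?T (qN j ^ i)\<bar>)"
        unfolding sum_subtractf[symmetric] by (rule sum_abs)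
      also have "\<dots> \<le> (\<Sum>i<n j - k. e / 2)" using elim(2) by (intro sum_mono) auto
      also have "\<dots> \<le> (\<Sum>i<n j. e / 2)" using e by (intro sum_mono2) auto
      finally have 2: "\<bar>(\<Sum>i<n j - k. ?J i) - (\<Sum>i<n j - k. ?T (qN j ^ i))\<bar> \<le> real (n j) * (e / 2)" by simp
      have "(\<Sum>i<n j. ?T (qN j ^ i)) = (\<Sum>i\<in>{..<n j - k} \<union> {n j - k..<n j}. ?T (qN j ^ i))"
        by (rule sum.cong) auto
      also have "\<dots> = (\<Sum>i<n j - k. ?T (qN j ^ i)) + (\<Sum>i=n j - k..<n j. ?T (qN j ^ i))"
        by (rule sum.union_disjoint) auto
      finally have "(\<Sum>i<n j. ?T (qN j ^ i)) = (\<Sum>i<n j - k. ?T (qN j ^ i)) + (\<Sum>i=n j - k..<n j. ?T (qN j ^ i))" .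
      moreover have "\<bar>\<Sum>i=n j - k..<n j. ?T (qN j ^ i)\<bar> \<le> (\<Sum>i=n j - k..<n j. 1)"
        by (rule order.trans[OF sum_abs sum_mono]) (rule abs_toeplitz_power_le_1[OF pow01])
      moreover have "(\<Sum>i=n j - k..<n j. 1) \<le> real k" by simp
      ultimately have "\<bar>S - (\<Sum>i<n j. ?T (qN j ^ i))\<bar> \<le> 2 * real k + real (n j) * (e / 2)"
        using 1 2 by linarith
      hence "\<bar>S - (\<Sum>i<n j. ?T (qN j ^ i))\<bar> / real (n j) \<le> (2 * real k + real (n j) * (e / 2)) / real (n j)"
        by (rule divide_right_mono) simp
      also have "\<dots> = 2 * real k / real (n j) + e / 2" using elim(4) by (simp add: add_divide_distrib)
      also have "\<dots> < e" using elim(1) by simp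
      also have "\<bar>S - (\<Sum>i<n j. ?T (qN j ^ i))\<bar> / real (n j) = dist (?z j - ?r j) 0"
        by (simp add: zero_counting_integral_p S_def dist_real_def flip: diff_divide_distrib)
      finally show ?case .
    qed
  qed
  from tendsto_add[OF this r] show ?thesis by simp
qed

lemma zero_counting_integral_diff_le:
  assumes "N j > 0" "n j > 0" and fg: "\<And>x. x \<in> {0..1} \<Longrightarrow> \<bar>f x - g x\<bar> \<le> e"
  shows "\<bar>zero_counting_integral (n j) (little_q_laguerre (aN j) (qN j) (n j)) f
     - zero_counting_integral (n j) (little_q_laguerre (aN j) (qN j) (n j)) g\<bar> \<le> e"
proof -
  interpret little_q_laguerre_params "aN j" "qN j" by (rule params[OF assms(1)])
  let ?R = "{x. poly (p (n j)) x = 0}"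
  have "\<bar>(\<Sum>x\<in>?R. f x) - (\<Sum>x\<in>?R. g x)\<bar> \<le> (\<Sum>x\<in>?R. \<bar>f x - g x\<bar>)"
    unfolding sum_subtractf[symmetric] by (rule sum_abs)
  also have "\<dots> \<le> (\<Sum>x\<in>?R. e)"
    using roots_p_subset[of "n j"] by (intro sum_mono fg) auto
  also have "\<dots> = real (n j) * e" by (simp add: card_roots_p)
  finally have "\<bar>(\<Sum>x\<in>?R. f x) - (\<Sum>x\<in>?R. g x)\<bar> / real (n j) \<le> e"
    using assms(2) by (simp add: field_simps)
  thus ?thesis
    by (simp add: zero_counting_integral_p flip: diff_divide_distrib)
qed

lemma zero_counting_tendsto:
  assumes f: "continuous_on {0..1} f"
  shows "(\<lambda>j. zero_counting_integral (n j) (little_q_laguerre (aN j) (qN j) (n j)) f)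
     \<longlonglongrightarrow> integral {0..1} (\<lambda>x. f x * rho_qMP c lam x)"
proof (rule tendstoI)
  let ?\<rho> = "rho_qMP c lam"
  let ?z = "\<lambda>j. zero_counting_integral (n j) (little_q_laguerre (aN j) (qN j) (n j))"
  fix e :: real assume "e > 0"
  \<comment> \<open>Three errors occur: the polynomial approximation under each of the two
    probability measures, and the convergence for the polynomial.\<close>
  define \<epsilon> where "\<epsilon> = e / 4"
  have \<epsilon>: "\<epsilon> > 0" using \<open>e > 0\<close> by (simp add: \<epsilon>_def)
  obtain g where g: "real_polynomial_function g" "\<And>x. x \<in> {0..1} \<Longrightarrow> \<bar>f x - g x\<bar> < \<epsilon>"
    using Stone_Weierstrass_real_polynomial_function[OF compact_Icc f \<epsilon>] by blast
  obtain a m where g_eq: "g = (\<lambda>x. \<Sum>i\<le>m. a i * x ^ i)"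
    using real_polynomial_function_imp_sum[OF g(1)] by blast
  have rho1: "(?\<rho> has_integral 1) {0..1}"
    using moment_rho[of 0] by (simp add: toeplitz_power_0)
  \<comment> \<open>Nonnegativity gives absolute integrability, which survives multiplication by any
    bounded measurable function.\<close>
  have "?\<rho> absolutely_integrable_on {0..1}"
    using rho1 rho_nonneg by (intro nonnegative_absolutely_integrable_1) auto
  hence int: "(\<lambda>x. h x * ?\<rho> x) integrable_on {0..1}" if h: "continuous_on {0..1} h" for h
  proof -
    have "(\<lambda>x. h x * ?\<rho> x) absolutely_integrable_on {0..1}"
    proof (rule absolutely_integrable_bounded_measurable_product_real)
      show "h \<in> borel_measurable (lebesgue_on {0..1})"
        using h by (intro continuous_imp_measurable_on_sets_lebesgue) auto
      show "bounded (h ` {0..1})"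
        using h by (intro compact_imp_bounded compact_continuous_image) auto
    qed (use \<open>?\<rho> absolutely_integrable_on {0..1}\<close> in auto)
    thus ?thesis by (rule set_lebesgue_integral_eq_integral(1))
  qed
  have contg: "continuous_on {0..1} g" unfolding g_eq by (intro continuous_intros)
  have "integral {0..1} (\<lambda>x. g x * ?\<rho> x) = integral {0..1} (\<lambda>x. \<Sum>i\<le>m. a i * (x ^ i * ?\<rho> x))"
    unfolding g_eq by (simp add: sum_distrib_right mult.assoc)
  also have "\<dots> = (\<Sum>i\<le>m. a i * integral {0..1} (\<lambda>x. x ^ i * ?\<rho> x))"
  proof (subst integral_sum)
    show "(\<lambda>x. a i * (x ^ i * ?\<rho> x)) integrable_on {0..1}" for i
      using int[of "\<lambda>x. a i * x ^ i"] by (simp add: mult.assoc continuous_intros)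
  qed auto
  finally have Ig: "integral {0..1} (\<lambda>x. g x * ?\<rho> x) = (\<Sum>i\<le>m. a i * integral {0..1} (\<lambda>x. x ^ i * ?\<rho> x))" .
  have "(\<lambda>j. ?z j g) \<longlonglongrightarrow> integral {0..1} (\<lambda>x. g x * ?\<rho> x)"
    unfolding Ig unfolding g_eq zero_counting_integral_sum by (intro tendsto_intros moments_tendsto)
  hence z_close: "eventually (\<lambda>j. dist (?z j g) (integral {0..1} (\<lambda>x. g x * ?\<rho> x)) < \<epsilon>) sequentially"
    using \<epsilon> by (rule tendstoD)
  have int_close: "\<bar>integral {0..1} (\<lambda>x. f x * ?\<rho> x) - integral {0..1} (\<lambda>x. g x * ?\<rho> x)\<bar> \<le> \<epsilon>"
  proof -
    have "integral {0..1} (\<lambda>x. f x * ?\<rho> x) - integral {0..1} (\<lambda>x. g x * ?\<rho> x)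
        = integral {0..1} (\<lambda>x. (f x - g x) * ?\<rho> x)"
      by (simp add: left_diff_distrib integral_diff int f contg)
    moreover have "norm (integral {0..1} (\<lambda>x. (f x - g x) * ?\<rho> x)) \<le> integral {0..1} (\<lambda>x. \<epsilon> * ?\<rho> x)"
    proof (rule integral_norm_bound_integral)
      show "(\<lambda>x. (f x - g x) * ?\<rho> x) integrable_on {0..1}" by (intro int continuous_intros f contg)
      show "(\<lambda>x. \<epsilon> * ?\<rho> x) integrable_on {0..1}" by (intro int continuous_intros)
      show "norm ((f x - g x) * ?\<rho> x) \<le> \<epsilon> * ?\<rho> x" if "x \<in> {0..1}" for x
        using g(2)[OF that] rho_nonneg[OF that] by (auto simp: abs_mult intro!: mult_right_mono)
    qed
    moreover have "integral {0..1} (\<lambda>x. \<epsilon> * ?\<rho> x) = \<epsilon>"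
      using integral_unique[OF rho1] by simp
    ultimately show ?thesis by (simp only: real_norm_def)
  qed
  from z_close N_pos n_pos
  show "eventually (\<lambda>j. dist (?z j f) (integral {0..1} (\<lambda>x. f x * ?\<rho> x)) < e) sequentially"
  proof eventually_elim
    case (elim j)
    have "\<bar>?z j f - ?z j g\<bar> \<le> \<epsilon>"
      by (rule zero_counting_integral_diff_le) (use elim g(2) in \<open>auto intro: less_imp_le\<close>)
    thus ?case using elim \<epsilon> int_close unfolding dist_real_def \<epsilon>_def by linarith
  qed
qed

end

end

theorem theorem1p2:
  fixes c lam :: real and d :: nat
    and n N :: "nat \<Rightarrow> nat"
    and f :: "real \<Rightarrow> real"
  assumes "c \<ge> 0" and "lam > 0"
    and "filterlim n at_top sequentially"
    and "filterlim N at_top sequentially"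
    and "(\<lambda>k. real (n k) / real (N k)) \<longlonglongrightarrow> 1"
    and "continuous_on {0..1} f"
  shows "(\<lambda>k. let q = exp (- lam / real (N k));
                  a = q powr (c * real (N k) + real d)
              in zero_counting_integral (n k) (little_q_laguerre a q (n k)) f)
         \<longlonglongrightarrow> integral {0..1} (\<lambda>x. f x * rho_qMP c lam x)"
proof -
  interpret qMP_params c lam by unfold_locales (use assms in auto)
  show ?thesis
    using zero_counting_tendsto[OF assms(3-6), of d]
    by (simp only: Let_def qN_def[OF assms(3-5)] aN_def[OF assms(3-5)])
qed

end
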